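(* Let $v_{ij}(x), w_{ij}(x) \in \mathbf{Z}[x]$ for $0 \le i \le s$ and $1 \le j \le d$, with each $w_{ij}$ not the zero polynomial. For each positive integer $n$ with $w_{ij}(n) \neq 0$ for all $i,j$ (which holds for all sufficiently large $n$), let $p^i(n) = \left(\frac{v_{i1}(n)}{w_{i1}(n)}, \dots, \frac{v_{id}(n)}{w_{id}(n)}\right) \in \mathbf{Q}^d$ and let $P(n) = \operatorname{conv}(p^0(n), p^1(n), \dots, p^s(n)) \subset \mathbf{R}^d$. Then the function $n \mapsto \#(P(n) \cap \mathbf{Z}^d)$ lies in $\mathbf{QP}_{\gg 0}$.
   Context: A function $f$ defined on all sufficiently large integers with integer values is eventually a quasi-polynomial if there exist a positive integer $s$ and polynomials $f_0,\dots,f_{s-1} \in \mathbf{Q}[t]$ such that $f(n) = f_i(n)$ for all sufficiently large $n$ with $n \equiv i \pmod s$. $\mathbf{QP}_{\gg 0}$ denotes the set of such functions. *)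

theory Defs
  imports "HOL-Analysis.Analysis" "HOL-Computational_Algebra.Polynomial" "HOL-Number_Theory.Cong"
begin

text \<open>
  A function defined only on all sufficiently large integers is represented by any of its total
  extensions; membership in \<open>QP_eventually\<close> depends only on its values at large arguments.
\<close>

definition QP_eventually :: "(int \<Rightarrow> int) set" where
  "QP_eventually = {f. \<exists>s::nat. s > 0 \<and> (\<exists>g :: nat \<Rightarrow> rat poly. \<forall>i<s.
     eventually (\<lambda>n. [n = int i] (mod int s) \<longrightarrow> of_int (f n) = poly (g i) (of_int n)) at_top)}"

definition integer_lattice :: "(real ^ 'd) set" where
  "integer_lattice = {x. \<forall>j. x $ j \<in> \<int>}"

definition ratio_point :: "('d \<Rightarrow> int poly) \<Rightarrow> ('d \<Rightarrow> int poly) \<Rightarrow> int \<Rightarrow> real ^ 'd" where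
  "ratio_point v w n = (\<chi> j. of_int (poly (v j) n) / of_int (poly (w j) n))"

definition ratio_polytope ::
    "nat \<Rightarrow> (nat \<Rightarrow> 'd \<Rightarrow> int poly) \<Rightarrow> (nat \<Rightarrow> 'd \<Rightarrow> int poly) \<Rightarrow> int \<Rightarrow> (real ^ 'd) set" where
  "ratio_polytope s v w n = convex hull ((\<lambda>i. ratio_point (v i) (w i) n) ` {0..s})"

end

theory Submission
  imports Defs
begin

text \<open>
  Fourier--Motzkin elimination of the barycentric coordinates describes \<open>P(n)\<close>, for large \<open>n\<close>, by finitely
  many linear inequalities with coefficients in \<open>\<int>[n]\<close>. The lattice points are polynomially bounded in \<open>n\<close>, so
  after a shift and the introduction of slack variables all unknowns can be written in base \<open>n\<close> with a fixed
  number of digits. Comparing digits, with carries from a fixed finite range, turns every equation into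
  finitely many alternative systems of equations with constant integer coefficients and right-hand sides
  affine in \<open>n\<close>. Treating \<open>n\<close> as one more unknown, Elliott's reduction partitions the solutions
  into pieces counted by the number of \<open>z \<in> \<nat>\<^sup>k\<close> with \<open>d\<^sub>1 z\<^sub>1 + \<dots> + d\<^sub>k z\<^sub>k = n - e\<close> where all
  \<open>d\<^sub>i > 0\<close>; these restricted partition functions are eventually quasi-polynomials.
\<close>

section \<open>Quasi-polynomials\<close>

text \<open>The facet normals of P(n) vary with n, so Ehrhart theory for dilates of one fixed
  polytope does not apply directly. Base-n digits remove this obstacle: when every unknown lies in
  [0, n), the part of an equation that belongs to one power of n is at most a constant times n, and
  this bounds the carries independently of n. Afterwards n occurs only in right-hand sides and in
  the bounds on the digits. Making n an unknown, with one extra row n = N, turns all of this into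
  constants except the right-hand side of that row.

  Elliott's reduction respects the extra row: its coefficients are nonnegative and are only ever
  added to each other. Every intermediate system also inherits having finitely many solutions. When
  only the extra row is left, a zero coefficient would let its unknown vary freely, so finiteness
  leaves either no solutions or positive d_i throughout. Adding one part to a restricted partition
  function solves a difference equation; hence quasi-polynomials must be closed under
  antidifferences, besides sums and shifts.\<close>

definition qp :: "int \<Rightarrow> (int \<Rightarrow> int) \<Rightarrow> bool" where
  "qp s f \<longleftrightarrow> (\<exists>(g :: int \<Rightarrow> rat poly) N. \<forall>n\<ge>N. of_int (f n) = poly (g (n mod s)) (of_int n))"

text \<open>\<open>qp\<close> keeps the period as a parameter. With a common period, sums and shifts
  can be carried out on the constituents, and different periods are reconciled by passing to their
  product.\<close>

lemma QP_eventually_iff_qp: "f \<in> QP_eventually \<longleftrightarrow> (\<exists>s>0. qp s f)"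
proof
  assume "f \<in> QP_eventually"
  then obtain s :: nat and g :: "nat \<Rightarrow> rat poly" where s: "s > 0"
    and "\<forall>i<s. eventually (\<lambda>n. [n = int i] (mod int s) \<longrightarrow> of_int (f n) = poly (g i) (of_int n)) at_top"
    unfolding QP_eventually_def by blast
  then have "eventually (\<lambda>n. \<forall>i\<in>{..<s}. [n = int i] (mod int s) \<longrightarrow>
      of_int (f n) = poly (g i) (of_int n)) at_top"
    by (intro eventually_ball_finite) auto
  then obtain N where N: "\<And>n i. n \<ge> N \<Longrightarrow> i < s \<Longrightarrow> [n = int i] (mod int s) \<Longrightarrow>
      of_int (f n) = poly (g i) (of_int n)"
    by (auto simp: eventually_at_top_linorder)
  have "of_int (f n) = poly (g (nat (n mod int s))) (of_int n)" if "n \<ge> N" for n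
    using s that by (intro N) (auto simp: cong_def nat_less_iff)
  then have "qp (int s) f"
    unfolding qp_def by (intro exI[of _ "\<lambda>i. g (nat i)"] exI[of _ N]) auto
  then show "\<exists>s>0. qp s f"
    using s by (intro exI[of _ "int s"]) auto
next
  assume "\<exists>s>0. qp s f"
  then obtain s g N where s: "s > 0"
    and N: "\<And>n. n \<ge> N \<Longrightarrow> of_int (f n) = poly (g (n mod s) :: rat poly) (of_int n)"
    unfolding qp_def by blast
  have "eventually (\<lambda>n. [n = int i] (mod int (nat s)) \<longrightarrow>
      of_int (f n) = poly (g (int i)) (of_int n)) at_top" if "i < nat s" for i
    using N that s by (intro eventually_at_top_linorderI[of N]) (auto simp: cong_def)
  then show "f \<in> QP_eventually"
    unfolding QP_eventually_def using s by (auto intro!: exI[of _ "nat s"] exI[of _ "\<lambda>i. g (int i)"])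
qed

section \<open>Closure under sums, shifts and change of period\<close>

lemma qp_cong:
  assumes "qp s f" "\<And>n. n \<ge> N \<Longrightarrow> f n = f' n"
  shows "qp s f'"
proof -
  obtain g :: "int \<Rightarrow> rat poly" and N' where
    "\<And>n. n \<ge> N' \<Longrightarrow> of_int (f n) = poly (g (n mod s)) (of_int n)"
    using assms(1) unfolding qp_def by blast
  then show ?thesis
    unfolding qp_def
    by (intro exI[of _ g] exI[of _ "max N N'"]) (auto simp: assms(2)[symmetric])
qed

lemma qp_const: "qp s (\<lambda>n. c)"
  unfolding qp_def by (intro exI[of _ "\<lambda>_. [:of_int c:]"] exI[of _ 0]) auto

lemma qp_add:
  assumes "qp s f" "qp s g"
  shows "qp s (\<lambda>n. f n + g n)"
proof -
  obtain F M where F: "\<And>n. n \<ge> M \<Longrightarrow> of_int (f n) = poly (F (n mod s) :: rat poly) (of_int n)"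
    using assms(1) unfolding qp_def by blast
  obtain G N where G: "\<And>n. n \<ge> N \<Longrightarrow> of_int (g n) = poly (G (n mod s) :: rat poly) (of_int n)"
    using assms(2) unfolding qp_def by blast
  show ?thesis
    unfolding qp_def
    by (intro exI[of _ "\<lambda>i. F i + G i"] exI[of _ "max M N"]) (auto simp: F G)
qed

lemma qp_sum:
  assumes "\<And>x. x \<in> X \<Longrightarrow> qp s (f x)"
  shows "qp s (\<lambda>n. \<Sum>x\<in>X. f x n)"
  using assms by (induction X rule: infinite_finite_induct) (auto intro: qp_const qp_add)

lemma qp_shift:
  assumes "qp s f"
  shows "qp s (\<lambda>n. f (n - k))"
proof -
  obtain g N where g: "\<And>n. n \<ge> N \<Longrightarrow> of_int (f n) = poly (g (n mod s) :: rat poly) (of_int n)"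
    using assms unfolding qp_def by blast
  show ?thesis
    unfolding qp_def
    by (intro exI[of _ "\<lambda>i. pcompose (g ((i - k) mod s)) [:- of_int k, 1:]"] exI[of _ "N + k"])
      (auto simp: g poly_pcompose mod_diff_left_eq)
qed

lemma qp_mult_period:
  assumes "qp s f" "s dvd t"
  shows "qp t f"
proof -
  obtain g N where g: "\<And>n. n \<ge> N \<Longrightarrow> of_int (f n) = poly (g (n mod s) :: rat poly) (of_int n)"
    using assms unfolding qp_def by blast
  show ?thesis
    unfolding qp_def
    by (intro exI[of _ "\<lambda>i. g (i mod s)"] exI[of _ N]) (auto simp: g mod_mod_cancel[OF assms(2)])
qed

lemma QP_eventually_cong:
  assumes "f \<in> QP_eventually" "eventually (\<lambda>n. f n = f' n) at_top"
  shows "f' \<in> QP_eventually"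
  using assms qp_cong unfolding QP_eventually_iff_qp eventually_at_top_linorder by blast

lemma QP_eventually_const: "(\<lambda>n. c) \<in> QP_eventually"
  unfolding QP_eventually_iff_qp using qp_const zero_less_one by blast

lemma QP_eventually_add:
  assumes "f \<in> QP_eventually" "g \<in> QP_eventually"
  shows "(\<lambda>n. f n + g n) \<in> QP_eventually"
proof -
  obtain s t where "s > 0" "qp s f" "t > 0" "qp t g"
    using assms unfolding QP_eventually_iff_qp by blast
  then have "s * t > 0" "qp (s * t) (\<lambda>n. f n + g n)"
    by (auto intro!: qp_add intro: qp_mult_period)
  then show ?thesis
    unfolding QP_eventually_iff_qp by blast
qed

lemma QP_eventually_sum:
  assumes "\<And>x. x \<in> X \<Longrightarrow> f x \<in> QP_eventually"
  shows "(\<lambda>n. \<Sum>x\<in>X. f x n) \<in> QP_eventually"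
  using assms
  by (induction X rule: infinite_finite_induct) (auto intro: QP_eventually_const QP_eventually_add)

lemma QP_eventually_shift: "f \<in> QP_eventually \<Longrightarrow> (\<lambda>n. f (n - k)) \<in> QP_eventually"
  unfolding QP_eventually_iff_qp using qp_shift by blast

section \<open>Discrete antidifferences\<close>

text \<open>
  The rising products \<open>P k x = x (x + M) \<dots> (x + (k - 1) M)\<close> satisfy
  \<open>P (k + 1) x - P (k + 1) (x - M) = (k + 1) M P k x\<close> and \<open>x P k x = P (k + 1) x - k M P k x\<close>.
\<close>

lemma poly_antidifference_rising:
  fixes M :: "'a::field_char_0" and H :: "'a poly"
  assumes "M \<noteq> 0"
  shows "\<exists>G. \<forall>x. poly G x - poly G (x - M) = (\<Prod>i<k. x + of_nat i * M) * poly H x"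
proof (induction H arbitrary: k)
  case 0
  show ?case by (intro exI[of _ 0]) auto
next
  case (pCons a H)
  define P where "P k x = (\<Prod>i<k. x + of_nat i * M)" for k x
  define R where "R = (\<Prod>i<Suc k. [:of_nat i * M, 1:])"
  have R: "poly R x = P (Suc k) x" for x
    by (simp add: R_def P_def poly_prod algebra_simps)
  have shift: "P (Suc k) (x - M) = (x - M) * P k x" for x
    unfolding P_def by (subst prod.lessThan_Suc_shift) (auto simp: algebra_simps)
  have P_Suc: "P (Suc k) x = P k x * (x + of_nat k * M)" for x
    by (simp add: P_def)
  obtain G1 where G1: "\<And>x. poly G1 x - poly G1 (x - M) = P (Suc k) x * poly H x"
    using pCons.IH[of "Suc k"] unfolding P_def by blast
  obtain G2 where G2: "\<And>x. poly G2 x - poly G2 (x - M) = P k x * poly H x"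
    using pCons.IH[of k] unfolding P_def by blast
  define c where "c = a / ((of_nat k + 1) * M)"
  have k: "of_nat k + 1 \<noteq> (0::'a)"
    by (metis of_nat_Suc of_nat_neq_0 add.commute)
  have c: "c * ((of_nat k + 1) * M) = a"
    using k assms by (simp add: c_def)
  \<comment> \<open>\<open>pCons a H\<close> evaluates to \<open>a + x * poly H x\<close>. The term
    with \<open>R\<close> accounts for the summand \<open>a\<close>; \<open>G1\<close> and
    \<open>G2\<close> account for \<open>x * poly H x\<close>. The factor \<open>x\<close> raises
    \<open>k\<close>, which is why the induction keeps \<open>k\<close> arbitrary.\<close>
  define G where "G = smult c R + G1 - smult (of_nat k * M) G2"
  have "poly G x - poly G (x - M) = P k x * poly (pCons a H) x" for x
  proof -
    have "poly G x - poly G (x - M) = c * (P (Suc k) x - P (Suc k) (x - M))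
        + (poly G1 x - poly G1 (x - M)) - of_nat k * M * (poly G2 x - poly G2 (x - M))"
      by (simp add: G_def R algebra_simps)
    also have "P (Suc k) x - P (Suc k) (x - M) = (of_nat k + 1) * M * P k x"
      unfolding shift by (simp add: P_Suc algebra_simps)
    also have "c * ((of_nat k + 1) * M * P k x)
        + (poly G1 x - poly G1 (x - M)) - of_nat k * M * (poly G2 x - poly G2 (x - M)) =
        c * ((of_nat k + 1) * M) * P k x
        + P k x * (x + of_nat k * M) * poly H x - of_nat k * M * (P k x * poly H x)"
      by (simp only: G1 G2 P_Suc mult.assoc)
    also have "\<dots> = P k x * poly (pCons a H) x"
      unfolding c by (simp add: algebra_simps)
    finally show ?thesis .
  qed
  then show ?case unfolding P_def by blast
qed

lemma poly_antidifference:
  fixes M :: "'a::field_char_0" and H :: "'a poly"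
  assumes "M \<noteq> 0"
  shows "\<exists>G. \<forall>x. poly G x - poly G (x - M) = poly H x"
  using poly_antidifference_rising[OF assms, of 0 H] by simp

text \<open>On one residue class mod \<open>M\<close> and for large n, \<open>g\<close> is a single
  polynomial and so has a polynomial antidifference with step \<open>M\<close>. The difference
  between \<open>f\<close> and this antidifference no longer changes along the class.\<close>

lemma qp_antidifference_period:
  assumes "M > 0" "qp M g" "\<And>n. f n = f (n - M) + g n"
  shows "qp M f"
proof -
  obtain H N where H: "\<And>n. n \<ge> N \<Longrightarrow> of_int (g n) = poly (H (n mod M) :: rat poly) (of_int n)"
    using assms(2) unfolding qp_def by blast
  have "\<exists>G. \<forall>x. poly G x - poly G (x - of_int M) = poly (H i) x" for i
    using assms(1) by (intro poly_antidifference) auto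
  then obtain G where G: "\<And>i x. poly (G i) x - poly (G i) (x - of_int M) = poly (H i) x"
    by metis
  \<comment> \<open>\<open>\<rho> i\<close> is the representative of the class of \<open>i\<close>
    in the window from \<open>N\<close> to \<open>N + M - 1\<close>, and \<open>\<kappa> i\<close>
    is the constant of summation, read off there.\<close>
  define \<rho> where "\<rho> i = N + (i - N) mod M" for i
  define \<kappa> where "\<kappa> i = of_int (f (\<rho> i)) - poly (G i) (of_int (\<rho> i))" for i
  have main: "of_int (f n) = poly (G (n mod M)) (of_int n) + \<kappa> (n mod M)" if "n \<ge> N" for n
    using that
  proof (induction "nat (n - N)" arbitrary: n rule: less_induct)
    case less
    show ?case
    proof (cases "n < N + M")
      case True
      have "(n mod M - N) mod M = n - N"
        using True less.prems by (simp add: mod_diff_left_eq)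
      then show ?thesis by (simp add: \<kappa>_def \<rho>_def)
    next
      case False
      have "of_int (f n) = of_int (f (n - M)) + poly (H (n mod M)) (of_int n)"
        using assms(3)[of n] H[of n] less.prems by simp
      also have "of_int (f (n - M)) = poly (G ((n - M) mod M)) (of_int (n - M)) + \<kappa> ((n - M) mod M)"
        using False assms(1) by (intro less.hyps) auto
      finally show ?thesis
        using G[of "n mod M" "of_int n"] by simp
    qed
  qed
  show ?thesis
    unfolding qp_def by (intro exI[of _ "\<lambda>i. G i + [:\<kappa> i:]"] exI[of _ N]) (auto simp: main)
qed

text \<open>The step \<open>a\<close> need not match the period \<open>s\<close> of
  \<open>g\<close>. Iterating the recursion \<open>s\<close> times gives step \<open>s * a\<close>,
  with a sum of \<open>s\<close> shifts of \<open>g\<close> as the new difference. That sum has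
  period \<open>s\<close>, hence also \<open>s * a\<close>, so step and period agree.\<close>

lemma QP_eventually_antidifference:
  assumes "a > 0" "g \<in> QP_eventually" "\<And>n. f n = f (n - a) + g n"
  shows "f \<in> QP_eventually"
proof -
  obtain s where s: "s > 0" "qp s g"
    using assms(2) unfolding QP_eventually_iff_qp by blast
  define h where "h n = (\<Sum>j<nat s. g (n - int j * a))" for n
  have "qp s h"
    unfolding h_def by (intro qp_sum qp_shift s)
  then have h: "qp (s * a) h"
    by (rule qp_mult_period) simp
  have "f n = f (n - int k * a) + (\<Sum>j<k. g (n - int j * a))" for n k
  proof (induction k)
    case (Suc k)
    show ?case
      using Suc assms(3)[of "n - int k * a"] by (simp add: algebra_simps)
  qed simp
  from this[of _ "nat s"] have step: "f n = f (n - s * a) + h n" for n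
    unfolding h_def using s by (metis int_nat_eq less_le)
  have "s * a > 0"
    using s assms(1) by simp
  then show ?thesis
    unfolding QP_eventually_iff_qp using qp_antidifference_period[OF _ h step] by blast
qed

section \<open>Nonnegative solutions of linear Diophantine systems\<close>

text \<open>The value 0 outside \<open>I\<close> makes a solution determined by its entries on
  \<open>I\<close>, so \<open>card\<close> counts vectors. The matrix \<open>c\<close> is indexed by
  unknowns first: \<open>c i\<close> is a column, and a change of unknowns is a function
  update.\<close>

definition nat_sols :: "'i set \<Rightarrow> 'r set \<Rightarrow> ('i \<Rightarrow> 'r \<Rightarrow> int) \<Rightarrow> ('r \<Rightarrow> int) \<Rightarrow> ('i \<Rightarrow> nat) set" where
  "nat_sols I R c b =
    {z. (\<forall>i. i \<notin> I \<longrightarrow> z i = 0) \<and> (\<forall>r\<in>R. (\<Sum>i\<in>I. c i r * int (z i)) = b r)}"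

section \<open>Splitting solutions by comparing two unknowns\<close>

lemma nat_sols_split_sum1:
  assumes "finite I" "i \<in> I" "j \<in> I" "i \<noteq> j"
  shows "(\<Sum>k\<in>I. c k r * int ((w(i := w i + w j)) k)) =
    (\<Sum>k\<in>I. (c(j := \<lambda>r. c i r + c j r)) k r * int (w k))"
proof -
  define I' where "I' = I - {i, j}"
  have I: "I = insert i (insert j I')" "i \<notin> I'" "j \<notin> I'" "finite I'"
    using assms by (auto simp: I'_def)
  have sum2: "sum f (insert i (insert j I')) = f i + (f j + sum f I')" for f :: "'a \<Rightarrow> int"
    using I(2-) assms(4) by simp
  have *: "(\<Sum>k\<in>I'. c k r * int ((w(i := w i + w j)) k)) =
      (\<Sum>k\<in>I'. (c(j := \<lambda>r. c i r + c j r)) k r * int (w k))"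
    using I by (intro sum.cong) auto
  show ?thesis
    unfolding I(1) sum2 * using assms(4) by (simp add: algebra_simps)
qed

text \<open>The case z i < z j, with \<open>w j\<close> standing for z j - z i - 1. The 1 that
  encodes strictness contributes the constant \<open>c j r\<close>, which later moves to the
  right-hand side.\<close>

lemma nat_sols_split_sum2:
  assumes "finite I" "i \<in> I" "j \<in> I" "i \<noteq> j"
  shows "(\<Sum>k\<in>I. c k r * int ((w(j := w i + 1 + w j)) k)) =
    (\<Sum>k\<in>I. (c(i := \<lambda>r. c i r + c j r)) k r * int (w k)) + c j r"
proof -
  define I' where "I' = I - {i, j}"
  have I: "I = insert i (insert j I')" "i \<notin> I'" "j \<notin> I'" "finite I'"
    using assms by (auto simp: I'_def)
  have sum2: "sum f (insert i (insert j I')) = f i + (f j + sum f I')" for f :: "'a \<Rightarrow> int"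
    using I(2-) assms(4) by simp
  have *: "(\<Sum>k\<in>I'. c k r * int ((w(j := w i + 1 + w j)) k)) =
      (\<Sum>k\<in>I'. (c(i := \<lambda>r. c i r + c j r)) k r * int (w k))"
    using I by (intro sum.cong) auto
  show ?thesis
    unfolding I(1) sum2 * using assms(4) by (simp add: algebra_simps)
qed

text \<open>If z j \<le> z i, replace entry i by z i - z j; otherwise replace entry j by z j - z i -
  1. The maps \<open>\<phi>\<close> and \<open>\<psi>\<close> undo these replacements. They are
  injective, and comparing entries i and j tells their images apart, so finiteness passes to both
  parts and the cardinalities add.\<close>

lemma card_nat_sols_split:
  fixes c :: "'i \<Rightarrow> 'r \<Rightarrow> int"
  assumes I: "finite I" "i \<in> I" "j \<in> I" "i \<noteq> j" and fin: "finite (nat_sols I R c b)"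
  defines "S \<equiv> nat_sols I R (c(j := \<lambda>r. c i r + c j r)) b"
    and "T \<equiv> nat_sols I R (c(i := \<lambda>r. c i r + c j r)) (\<lambda>r. b r - c j r)"
  shows "finite S" "finite T" "card (nat_sols I R c b) = card S + card T"
proof -
  define \<phi> where "\<phi> w = w(i := w i + w j)" for w :: "'i \<Rightarrow> nat"
  define \<psi> where "\<psi> w = w(j := w i + 1 + w j)" for w :: "'i \<Rightarrow> nat"
  have \<phi>: "\<phi> w \<in> nat_sols I R c b \<longleftrightarrow> w \<in> S" for w
  proof -
    have "(\<forall>k. k \<notin> I \<longrightarrow> \<phi> w k = 0) \<longleftrightarrow> (\<forall>k. k \<notin> I \<longrightarrow> w k = 0)"
      using I by (auto simp: \<phi>_def)
    then show ?thesis
      unfolding S_def nat_sols_def \<phi>_def mem_Collect_eq nat_sols_split_sum1[OF I] by simp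
  qed
  have \<psi>: "\<psi> w \<in> nat_sols I R c b \<longleftrightarrow> w \<in> T" for w
  proof -
    have "(\<forall>k. k \<notin> I \<longrightarrow> \<psi> w k = 0) \<longleftrightarrow> (\<forall>k. k \<notin> I \<longrightarrow> w k = 0)"
      using I by (auto simp: \<psi>_def)
    then show ?thesis
      unfolding T_def nat_sols_def \<psi>_def mem_Collect_eq nat_sols_split_sum2[OF I]
      by (simp add: eq_diff_eq)
  qed
  have inj: "inj_on \<phi> S" "inj_on \<psi> T"
  proof -
    show "inj_on \<phi> S"
    proof (rule inj_onI)
      fix v w assume eq: "\<phi> v = \<phi> w"
      have "v k = w k" for k
        using fun_cong[OF eq, of k] fun_cong[OF eq, of j] I(4)
        by (auto simp: \<phi>_def split: if_splits)
      then show "v = w" by blast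
    qed
    show "inj_on \<psi> T"
    proof (rule inj_onI)
      fix v w assume eq: "\<psi> v = \<psi> w"
      have "v k = w k" for k
        using fun_cong[OF eq, of k] fun_cong[OF eq, of i] I(4)
        by (auto simp: \<psi>_def split: if_splits)
      then show "v = w" by blast
    qed
  qed
  have un: "nat_sols I R c b = \<phi> ` S \<union> \<psi> ` T"
  proof
    show "nat_sols I R c b \<subseteq> \<phi> ` S \<union> \<psi> ` T"
    proof
      fix z assume z: "z \<in> nat_sols I R c b"
      show "z \<in> \<phi> ` S \<union> \<psi> ` T"
      proof (cases "z j \<le> z i")
        case True
        then have "z = \<phi> (z(i := z i - z j))"
          using I(4) by (auto simp: \<phi>_def)
        then show ?thesis using \<phi> z by (metis UnI1 image_eqI)
      next
        case False
        then have "z = \<psi> (z(j := z j - z i - 1))"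
          using I(4) by (auto simp: \<psi>_def)
        then show ?thesis using \<psi> z by (metis UnI2 image_eqI)
      qed
    qed
  qed (use \<phi> \<psi> in auto)
  have "\<phi> v \<noteq> \<psi> w" for v w
  proof
    assume eq: "\<phi> v = \<psi> w"
    show False
      using I(4) fun_cong[OF eq, of i] fun_cong[OF eq, of j] by (auto simp: \<phi>_def \<psi>_def)
  qed
  then have disj: "\<phi> ` S \<inter> \<psi> ` T = {}" by auto
  have fin': "finite (\<phi> ` S)" "finite (\<psi> ` T)"
    using fin unfolding un by auto
  show "finite S" "finite T"
    using fin' inj by (auto dest: finite_imageD)
  show "card (nat_sols I R c b) = card S + card T"
    unfolding un using fin' disj inj by (simp add: card_Un_disjoint card_image)
qed

text \<open>
  The unknowns that occur in a row with nonnegative coefficients can take only finitely many values.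
\<close>

lemma card_nat_sols_nonneg_row:
  fixes c :: "'i \<Rightarrow> 'r \<Rightarrow> int" and R :: "'r set"
  assumes I: "finite I" and nonneg: "\<forall>i\<in>I. c i r \<ge> 0"
  defines "P \<equiv> {i\<in>I. c i r > 0}"
  defines "U \<equiv> \<lambda>\<beta>. {u :: 'i \<Rightarrow> nat. (\<forall>i. i \<notin> P \<longrightarrow> u i = 0) \<and> (\<Sum>i\<in>P. c i r * int (u i)) = \<beta>}"
  defines "T \<equiv> \<lambda>b u. nat_sols (I - P) R c (\<lambda>r. b r - (\<Sum>i\<in>P. c i r * int (u i)))"
  shows "finite (U \<beta>)"
    and "finite (nat_sols I (insert r R) c b) \<Longrightarrow> u \<in> U (b r) \<Longrightarrow> finite (T b u)"
    and "finite (nat_sols I (insert r R) c b) \<Longrightarrow>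
      card (nat_sols I (insert r R) c b) = (\<Sum>u\<in>U (b r). card (T b u))"
proof -
  have P: "finite P" "P \<subseteq> I"
    using I by (auto simp: P_def)
  show finU: "finite (U \<beta>)" for \<beta>
  proof (rule finite_subset)
    show "U \<beta> \<subseteq> {u. \<forall>i. (i \<in> P \<longrightarrow> u i \<in> {..nat \<beta>}) \<and> (i \<notin> P \<longrightarrow> u i = 0)}"
    proof safe
      fix u i assume u: "u \<in> U \<beta>" and i: "i \<in> P"
      \<comment> \<open>A positive integer coefficient is at least 1, and the other summands of the
        row are nonnegative, so each entry is at most the right-hand side.\<close>
      have "int (u i) \<le> c i r * int (u i)"
        using i by (cases "u i = 0") (auto simp: P_def)
      also have "\<dots> \<le> (\<Sum>i\<in>P. c i r * int (u i))"
        using i P nonneg by (intro member_le_sum) auto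
      also have "\<dots> = \<beta>" using u by (simp add: U_def)
      finally show "u i \<le> nat \<beta>" by simp
    qed (auto simp: U_def)
    show "finite {u. \<forall>i. (i \<in> P \<longrightarrow> u i \<in> {..nat \<beta>}) \<and> (i \<notin> P \<longrightarrow> u i = 0)}"
      by (intro finite_set_of_finite_funs P) auto
  qed
  define add where "add u z = (\<lambda>i. u i + z i)" for u z :: "'i \<Rightarrow> nat"
  have sum_add: "(\<Sum>i\<in>I. c i \<rho> * int (add u z i)) =
      (\<Sum>i\<in>P. c i \<rho> * int (u i)) + (\<Sum>i\<in>I - P. c i \<rho> * int (z i))"
    if "\<And>i. i \<notin> P \<Longrightarrow> u i = 0" "\<And>i. i \<notin> I - P \<Longrightarrow> z i = 0" for u z \<rho>
  proof -
    have "(\<Sum>i\<in>I. c i \<rho> * int (add u z i)) =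
      (\<Sum>i\<in>P. c i \<rho> * int (add u z i)) + (\<Sum>i\<in>I - P. c i \<rho> * int (add u z i))"
      by (subst sum.subset_diff[OF P(2) I]) (rule add.commute)
    also have "(\<Sum>i\<in>P. c i \<rho> * int (add u z i)) = (\<Sum>i\<in>P. c i \<rho> * int (u i))"
      using that by (intro sum.cong) (auto simp: add_def)
    also have "(\<Sum>i\<in>I - P. c i \<rho> * int (add u z i)) = (\<Sum>i\<in>I - P. c i \<rho> * int (z i))"
      using that by (intro sum.cong) (auto simp: add_def)
    finally show ?thesis .
  qed
  \<comment> \<open>Outside \<open>P\<close> the coefficients of row \<open>r\<close> are 0. The row
    therefore constrains \<open>u\<close> alone, and the system for the remaining unknowns no longer
    contains it.\<close>
  have zero: "(\<Sum>i\<in>I - P. c i r * int (z i)) = 0" for z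
    using nonneg by (intro sum.neutral) (force simp: P_def)
  have un: "nat_sols I (insert r R) c b = (\<Union>u\<in>U (b r). add u ` T b u)"
  proof (intro equalityI subsetI)
    fix x assume x: "x \<in> nat_sols I (insert r R) c b"
    define u where "u = (\<lambda>i. if i \<in> P then x i else 0)"
    define z where "z = (\<lambda>i. if i \<in> P then 0 else x i)"
    have xuz: "x = add u z" by (auto simp: add_def u_def z_def)
    have sup: "\<And>i. i \<notin> P \<Longrightarrow> u i = 0" "\<And>i. i \<notin> I - P \<Longrightarrow> z i = 0"
      using x by (auto simp: u_def z_def nat_sols_def)
    have eq: "(\<Sum>i\<in>P. c i \<rho> * int (u i)) + (\<Sum>i\<in>I - P. c i \<rho> * int (z i)) = b \<rho>"
      if "\<rho> \<in> insert r R" for \<rho>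
    proof -
      have "(\<Sum>i\<in>I. c i \<rho> * int (add u z i)) = b \<rho>"
        using x that unfolding xuz[symmetric] by (auto simp: nat_sols_def)
      then show ?thesis using sum_add[of u z \<rho>] sup by simp
    qed
    have "u \<in> U (b r)"
      using eq[of r] sup(1) zero[of z] by (auto simp: U_def)
    moreover have "z \<in> T b u"
      using eq sup(2) by (auto simp: T_def nat_sols_def eq_diff_eq add.commute)
    ultimately show "x \<in> (\<Union>u\<in>U (b r). add u ` T b u)"
      using xuz by blast
  next
    fix x assume "x \<in> (\<Union>u\<in>U (b r). add u ` T b u)"
    then obtain u z where u: "u \<in> U (b r)" and z: "z \<in> T b u" and x: "x = add u z" by blast
    have sup: "\<And>i. i \<notin> P \<Longrightarrow> u i = 0" "\<And>i. i \<notin> I - P \<Longrightarrow> z i = 0"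
      using u z by (auto simp: U_def T_def nat_sols_def)
    have "x i = 0" if "i \<notin> I" for i
      using sup that P by (auto simp: x add_def)
    moreover have "(\<Sum>i\<in>I. c i \<rho> * int (x i)) = b \<rho>" if "\<rho> \<in> insert r R" for \<rho>
    proof -
      have "(\<Sum>i\<in>I. c i \<rho> * int (x i)) =
          (\<Sum>i\<in>P. c i \<rho> * int (u i)) + (\<Sum>i\<in>I - P. c i \<rho> * int (z i))"
        using sum_add[of u z \<rho>] sup unfolding x by simp
      then show ?thesis
        using that u z zero[of z] by (auto simp: U_def T_def nat_sols_def)
    qed
    ultimately show "x \<in> nat_sols I (insert r R) c b"
      by (auto simp: nat_sols_def)
  qed
  have inj: "inj_on (add u) A" for u A
    by (rule inj_onI) (auto simp: add_def fun_eq_iff)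
  have disj: "add u ` T b u \<inter> add u' ` T b u' = {}" if "u \<in> U (b r)" "u' \<in> U (b r)" "u \<noteq> u'" for u u'
  proof (rule ccontr)
    assume "\<not> ?thesis"
    then obtain z z' where z: "z \<in> T b u" "z' \<in> T b u'" "add u z = add u' z'" by blast
    have "u i = u' i" for i
    proof (cases "i \<in> P")
      case True
      then have "z i = 0" "z' i = 0"
        using z(1,2) by (auto simp: T_def nat_sols_def)
      then show ?thesis
        using fun_cong[OF z(3), of i] by (simp add: add_def)
    qed (use that in \<open>simp add: U_def\<close>)
    then show False using that(3) by blast
  qed
  assume fin: "finite (nat_sols I (insert r R) c b)"
  have finT: "finite (T b u)" if "u \<in> U (b r)" for u
  proof -
    have "finite (add u ` T b u)"
      by (rule finite_subset[OF _ fin]) (use un that in auto)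
    then show ?thesis using inj by (rule finite_imageD)
  qed
  then show "u \<in> U (b r) \<Longrightarrow> finite (T b u)" .
  have "card (nat_sols I (insert r R) c b) = (\<Sum>u\<in>U (b r). card (add u ` T b u))"
    unfolding un using finU finT disj by (intro card_UN_disjoint) auto
  then show "card (nat_sols I (insert r R) c b) = (\<Sum>u\<in>U (b r). card (T b u))"
    by (simp add: card_image[OF inj])
qed

lemma nat_sols_neg_row:
  "nat_sols I R (\<lambda>i. (c i)(r := - c i r)) (b(r := - b r)) = nat_sols I R c b"
proof -
  have "(\<Sum>i\<in>I. ((c i)(r := - c i r)) \<rho> * int (z i)) = (b(r := - b r)) \<rho> \<longleftrightarrow>
      (\<Sum>i\<in>I. c i \<rho> * int (z i)) = b \<rho>" for \<rho> and z
    by (cases "\<rho> = r") (auto simp: sum_negf)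
  then show ?thesis by (simp add: nat_sols_def)
qed

text \<open>This is the restricted partition function with parts \<open>c i r0\<close>. Solutions
  for \<open>N\<close> that use part j correspond, by removing one copy of it, to the solutions for
  \<open>N - c j r0\<close>; the others are counted without j. With no parts left, the count is 0
  for every positive \<open>N\<close>.\<close>

lemma QP_eventually_card_nat_sols_pos_row:
  fixes c :: "'i \<Rightarrow> 'r \<Rightarrow> int"
  assumes "finite I" "\<And>i. i \<in> I \<Longrightarrow> c i r0 > 0"
  shows "(\<lambda>N. int (card (nat_sols I {r0} c (b(r0 := N))))) \<in> QP_eventually
    \<and> (\<forall>b. finite (nat_sols I {r0} c b))"
  using assms
proof (induction I rule: finite_induct)
  case empty
  have *: "nat_sols {} {r0} c b = (if b r0 = 0 then {\<lambda>_. 0} else {})" for b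
    by (auto simp: nat_sols_def)
  have "(\<lambda>N. int (card (nat_sols {} {r0} c (b(r0 := N))))) \<in> QP_eventually"
    by (rule QP_eventually_cong[OF QP_eventually_const[of 0]])
      (auto simp: * intro!: eventually_mono[OF eventually_gt_at_top[of 0]])
  then show ?case by (simp add: *)
next
  case (insert j I)
  have IH: "(\<lambda>N. int (card (nat_sols I {r0} c (b(r0 := N))))) \<in> QP_eventually"
    using insert by blast
  define a where "a = c j r0"
  have a: "a > 0" using insert by (auto simp: a_def)
  have fin: "finite (nat_sols (insert j I) {r0} c b)" for b
  proof -
    have "nat_sols (insert j I) {r0} c b =
      {u. (\<forall>i. i \<notin> {i\<in>insert j I. c i r0 > 0} \<longrightarrow> u i = 0) \<and>
        (\<Sum>i\<in>{i\<in>insert j I. c i r0 > 0}. c i r0 * int (u i)) = b r0}"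
    proof -
      have "{i\<in>insert j I. c i r0 > 0} = insert j I"
        using insert.prems by auto
      then show ?thesis by (simp add: nat_sols_def)
    qed
    then show ?thesis
      using card_nat_sols_nonneg_row(1)[of "insert j I" c r0 "b r0"] insert.prems insert.hyps
      by (simp add: less_imp_le)
  qed
  define f where "f N = int (card (nat_sols (insert j I) {r0} c (b(r0 := N))))" for N
  have step: "f N = f (N - a) + int (card (nat_sols I {r0} c (b(r0 := N))))" for N
  proof -
    define inc where "inc z = z(j := Suc (z j))" for z :: "'i \<Rightarrow> nat"
    have inj: "inj_on inc A" for A
      by (rule inj_onI) (metis (no_types, lifting) diff_Suc_1 fun_upd_same fun_upd_triv fun_upd_upd inc_def)
    have sum_insert: "(\<Sum>i\<in>insert j I. c i r0 * int (z i)) = a * int (z j) + (\<Sum>i\<in>I. c i r0 * int (z i))" for z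
      using insert.hyps by (simp add: a_def)
    have sum_inc: "(\<Sum>i\<in>I. c i r0 * int (inc z i)) = (\<Sum>i\<in>I. c i r0 * int (z i))" for z
      using insert.hyps by (intro sum.cong) (auto simp: inc_def)
    have inc: "inc z \<in> nat_sols (insert j I) {r0} c (b(r0 := N)) \<longleftrightarrow>
        z \<in> nat_sols (insert j I) {r0} c (b(r0 := N - a))" for z
    proof -
      have "(\<forall>i. i \<notin> insert j I \<longrightarrow> inc z i = 0) \<longleftrightarrow> (\<forall>i. i \<notin> insert j I \<longrightarrow> z i = 0)"
        by (auto simp: inc_def)
      moreover have "inc z j = Suc (z j)" by (simp add: inc_def)
      ultimately show ?thesis
        unfolding nat_sols_def mem_Collect_eq
        by (simp only: ball_simps sum_insert sum_inc) (simp add: algebra_simps eq_diff_eq)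
    qed
    have zero: "z \<in> nat_sols I {r0} c (b(r0 := N)) \<longleftrightarrow>
        z \<in> nat_sols (insert j I) {r0} c (b(r0 := N)) \<and> z j = 0" for z
      unfolding nat_sols_def mem_Collect_eq using insert.hyps
      by (simp only: ball_simps sum_insert) (auto, metis)
    have un: "nat_sols (insert j I) {r0} c (b(r0 := N)) =
        inc ` nat_sols (insert j I) {r0} c (b(r0 := N - a)) \<union> nat_sols I {r0} c (b(r0 := N))"
    proof (intro equalityI subsetI)
      fix z assume z: "z \<in> nat_sols (insert j I) {r0} c (b(r0 := N))"
      show "z \<in> inc ` nat_sols (insert j I) {r0} c (b(r0 := N - a)) \<union> nat_sols I {r0} c (b(r0 := N))"
      proof (cases "z j")
        case 0
        then show ?thesis using z zero by blast
      next
        case (Suc m)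
        then have "z = inc (z(j := m))" by (auto simp: inc_def)
        then show ?thesis using z inc by (metis UnI1 image_eqI)
      qed
    qed (use inc zero in auto)
    have "card (nat_sols (insert j I) {r0} c (b(r0 := N))) =
        card (inc ` nat_sols (insert j I) {r0} c (b(r0 := N - a))) + card (nat_sols I {r0} c (b(r0 := N)))"
      unfolding un
    proof (rule card_Un_disjoint)
      show "finite (nat_sols I {r0} c (b(r0 := N)))"
        using insert by blast
      show "inc ` nat_sols (insert j I) {r0} c (b(r0 := N - a)) \<inter> nat_sols I {r0} c (b(r0 := N)) = {}"
      proof (rule equals0I)
        fix z assume "z \<in> inc ` nat_sols (insert j I) {r0} c (b(r0 := N - a)) \<inter> nat_sols I {r0} c (b(r0 := N))"
        then have "z j \<noteq> 0" "z j = 0"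
          using zero[of z] by (auto simp: inc_def)
        then show False by simp
      qed
    qed (use fin in auto)
    then show ?thesis
      by (simp add: f_def card_image[OF inj])
  qed
  have "f \<in> QP_eventually"
    using a IH step by (rule QP_eventually_antidifference)
  then show ?case
    using fin unfolding f_def[abs_def] by blast
qed

text \<open>An unknown with zero column could take every value, so a single solution would produce
  infinitely many.\<close>

lemma finite_nat_sols_degenerate:
  assumes "finite I" "i \<in> I" "\<And>r. r \<in> R \<Longrightarrow> c i r = 0" "finite (nat_sols I R c b)"
  shows "nat_sols I R c b = {}"
proof (rule ccontr)
  assume "nat_sols I R c b \<noteq> {}"
  then obtain z where z: "z \<in> nat_sols I R c b" by blast
  have "z(i := m) \<in> nat_sols I R c b" for m
  proof -
    have "(\<Sum>k\<in>I. c k r * int ((z(i := m)) k)) = (\<Sum>k\<in>I. c k r * int (z k))" if "r \<in> R" for r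
      using assms(3)[OF that] by (intro sum.cong) auto
    then show ?thesis
      using z assms(2) by (auto simp: nat_sols_def)
  qed
  then have "range (\<lambda>m. z(i := m)) \<subseteq> nat_sols I R c b" by blast
  moreover have "inj (\<lambda>m. z(i := m))"
    by (rule injI) (auto dest: fun_upd_eqD)
  ultimately show False
    using assms(4) finite_imageD[of "\<lambda>m. z(i := m)" UNIV] finite_subset by auto
qed

lemma QP_eventually_card_nat_sols_one_row:
  fixes c :: "'i \<Rightarrow> 'r \<Rightarrow> int"
  assumes "finite I" "\<And>i. i \<in> I \<Longrightarrow> c i r0 \<ge> 0" "\<And>N. finite (nat_sols I {r0} c (b(r0 := N)))"
  shows "(\<lambda>N. int (card (nat_sols I {r0} c (b(r0 := N))))) \<in> QP_eventually"
proof (cases "\<exists>i\<in>I. c i r0 = 0")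
  case True
  then obtain i where "i \<in> I" "c i r0 = 0" by blast
  then have "nat_sols I {r0} c (b(r0 := N)) = {}" for N
    using assms by (intro finite_nat_sols_degenerate[of I i]) auto
  then show ?thesis by (simp add: QP_eventually_const)
next
  case False
  then have "c i r0 > 0" if "i \<in> I" for i
    using assms(2)[OF that] that by force
  then show ?thesis
    using assms(1) by (intro conjunct1[OF QP_eventually_card_nat_sols_pos_row])
qed

text \<open>
  Elliott's reduction. If a row has coefficients \<open>p > 0\<close> at \<open>i\<close> and \<open>- q < 0\<close> at \<open>j\<close>, the extreme ones, then
  splitting the solutions by \<open>z j \<le> z i\<close> or \<open>z i < z j\<close> replaces one of the two by \<open>p - q\<close>, which lies
  strictly between \<open>- q\<close> and \<open>p\<close>. This ends with a row of constant sign.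
\<close>

lemma QP_eventually_card_nat_sols:
  fixes c :: "'i \<Rightarrow> 'r \<Rightarrow> int"
  assumes "finite R" "r0 \<notin> R" "finite I" "\<And>i. i \<in> I \<Longrightarrow> c i r0 \<ge> 0"
    "\<And>N. finite (nat_sols I (insert r0 R) c (b(r0 := N)))"
  shows "(\<lambda>N. int (card (nat_sols I (insert r0 R) c (b(r0 := N))))) \<in> QP_eventually"
  using assms
proof (induction R arbitrary: I c b rule: finite_induct)
  case empty
  then show ?case by (intro QP_eventually_card_nat_sols_one_row)
next
  case (insert r R)
  have r: "r \<noteq> r0" "r \<notin> R" "r0 \<notin> R"
    using insert by auto
  have rows: "insert r0 (insert r R) = insert r (insert r0 R)"
    by auto
  note IH = insert.IH[OF r(3)]
  note [simp] = insert.prems(2)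
  have nonneg_row: "(\<lambda>N. int (card (nat_sols I (insert r (insert r0 R)) c (b(r0 := N))))) \<in> QP_eventually"
    if c0: "\<And>i. i \<in> I \<Longrightarrow> c i r0 \<ge> 0" and cr: "\<And>i. i \<in> I \<Longrightarrow> c i r \<ge> 0"
      and fin: "\<And>N. finite (nat_sols I (insert r (insert r0 R)) c (b(r0 := N)))"
    for c :: "'i \<Rightarrow> 'r \<Rightarrow> int" and b
  proof -
    define P where "P = {i\<in>I. c i r > 0}"
    define U where "U = {u :: 'i \<Rightarrow> nat. (\<forall>i. i \<notin> P \<longrightarrow> u i = 0) \<and> (\<Sum>i\<in>P. c i r * int (u i)) = b r}"
    define s where "s u \<rho> = (\<Sum>i\<in>P. c i \<rho> * int (u i))" for u :: "'i \<Rightarrow> nat" and \<rho>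
    \<comment> \<open>Fixing \<open>u\<close> changes the right-hand side of row \<open>r0\<close>
      from \<open>N\<close> to \<open>N - s u r0\<close>. Leaving the moving entry as a fresh
      \<open>N\<close> in \<open>T\<close> makes each summand a shift of a function covered by the
      induction hypothesis.\<close>
    define T where "T u N = nat_sols (I - P) (insert r0 R) c ((\<lambda>\<rho>. b \<rho> - s u \<rho>)(r0 := N))" for u N
    have T: "nat_sols (I - P) (insert r0 R) c (\<lambda>\<rho>. (b(r0 := N)) \<rho> - (\<Sum>i\<in>P. c i \<rho> * int (u i))) =
        T u (N - s u r0)" for u N
      unfolding T_def s_def by (rule arg_cong[of _ _ "nat_sols _ _ _"]) auto
    have cr': "\<forall>i\<in>I. c i r \<ge> 0"
      using cr by blast
    note nn = card_nat_sols_nonneg_row[of I c r, OF insert.prems(2) cr', folded P_def]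
    have U: "finite U"
      unfolding U_def using nn(1) by blast
    have finT: "finite (T u N)" if "u \<in> U" for u N
      using nn(2)[OF fin[of "N + s u r0"], of u] that r(1) unfolding T by (simp add: U_def)
    have card: "card (nat_sols I (insert r (insert r0 R)) c (b(r0 := N))) = (\<Sum>u\<in>U. card (T u (N - s u r0)))" for N
      using nn(3)[OF fin[of N]] r(1) unfolding T by (simp add: U_def)
    have "(\<lambda>N. int (card (T u N))) \<in> QP_eventually" if "u \<in> U" for u
      using insert.prems(2) c0 finT[OF that] unfolding T_def
      by (intro IH[of "I - P" c "\<lambda>\<rho>. b \<rho> - s u \<rho>"]) blast+
    then have "(\<lambda>N. \<Sum>u\<in>U. int (card (T u (N - s u r0)))) \<in> QP_eventually"
      by (intro QP_eventually_sum QP_eventually_shift)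
    then show ?thesis by (simp add: card)
  qed
  have nonpos_row: "(\<lambda>N. int (card (nat_sols I (insert r (insert r0 R)) c (b(r0 := N))))) \<in> QP_eventually"
    if c0: "\<And>i. i \<in> I \<Longrightarrow> c i r0 \<ge> 0" and cr: "\<And>i. i \<in> I \<Longrightarrow> c i r \<le> 0"
      and fin: "\<And>N. finite (nat_sols I (insert r (insert r0 R)) c (b(r0 := N)))"
    for c :: "'i \<Rightarrow> 'r \<Rightarrow> int" and b
  proof -
    have neg: "nat_sols I (insert r (insert r0 R)) (\<lambda>i. (c i)(r := - c i r)) ((b(r := - b r))(r0 := N)) =
        nat_sols I (insert r (insert r0 R)) c (b(r0 := N))" for N
      using nat_sols_neg_row[of I "insert r (insert r0 R)" c r "b(r0 := N)"] r(1)
      by (simp add: fun_upd_twist)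
    show ?thesis
      using nonneg_row[of "\<lambda>i. (c i)(r := - c i r)" "b(r := - b r)"] c0 cr fin r(1)
      unfolding neg by auto
  qed
  have "(\<lambda>N. int (card (nat_sols I (insert r (insert r0 R)) c (b(r0 := N))))) \<in> QP_eventually"
    if "\<And>i. i \<in> I \<Longrightarrow> c i r0 \<ge> 0" "\<And>i. i \<in> I \<Longrightarrow> - int q \<le> c i r \<and> c i r \<le> int p"
      "\<And>N. finite (nat_sols I (insert r (insert r0 R)) c (b(r0 := N)))"
    for c :: "'i \<Rightarrow> 'r \<Rightarrow> int" and b p q
    using that
  \<comment> \<open>A splitting lowers the number of extreme coefficients while \<open>p\<close> and
    \<open>q\<close> stay. When one extreme no longer occurs, \<open>p\<close> or \<open>q\<close>
    drops by 1 and that number may grow again, but to at most \<open>card I\<close>; the weight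
    \<open>card I + 1\<close> outweighs this.\<close>
  proof (induction "(p + q) * (card I + 1) + card {i\<in>I. c i r = int p \<or> c i r = - int q}"
      arbitrary: c b p q rule: less_induct)
    case (less c p q b)
    let ?k = "\<lambda>c. card {i\<in>I. c i r = int p \<or> c i r = - int q}"
    note c0 = less.prems(1) and bd = less.prems(2) and fin = less.prems(3)
    have k_le: "card {i\<in>I. Q i} \<le> card I" for Q
      by (intro card_mono) auto
    consider "p = 0" | "q = 0" | "p > 0" "q > 0" "\<forall>i\<in>I. c i r \<noteq> int p"
      | "p > 0" "q > 0" "\<forall>i\<in>I. c i r \<noteq> - int q"
      | i j where "p > 0" "q > 0" "i \<in> I" "j \<in> I" "c i r = int p" "c j r = - int q"
      by blast
    then show ?case
    proof cases
      case 1
      then show ?thesis using bd c0 fin by (intro nonpos_row) auto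
    next
      case 2
      then show ?thesis using bd c0 fin by (intro nonneg_row) auto
    next
      case 3
      then have *: "- int q \<le> c i r \<and> c i r \<le> int (p - 1)" if "i \<in> I" for i
        using bd[OF that] that by force
      obtain p' where p': "p = Suc p'"
        using 3 by (cases p) auto
      show ?thesis
        using k_le[of "\<lambda>i. c i r = int p' \<or> c i r = - int q"]
        by (intro less.hyps[of p' q c b] c0 fin) (use * p' in auto)
    next
      case 4
      then have *: "- int (q - 1) \<le> c i r \<and> c i r \<le> int p" if "i \<in> I" for i
        using bd[OF that] that by force
      obtain q' where q': "q = Suc q'"
        using 4 by (cases q) auto
      show ?thesis
        using k_le[of "\<lambda>i. c i r = int p \<or> c i r = - int q'"]
        by (intro less.hyps[of p q' c b] c0 fin) (use * q' in auto)
    next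
      case 5
      then have ij: "i \<noteq> j" by auto
      define cj where "cj = c(j := \<lambda>r. c i r + c j r)"
      define ci where "ci = c(i := \<lambda>r. c i r + c j r)"
      define b' where "b' \<rho> = b \<rho> - c j \<rho>" for \<rho>
      \<comment> \<open>The second piece of the splitting subtracts column \<open>j\<close> from all
        right-hand sides, including that of row \<open>r0\<close>. Its count is thus taken at
        \<open>N - c j r0\<close>, and its finiteness at every \<open>N\<close> comes from the
        hypothesis at \<open>N + c j r0\<close>.\<close>
      have b': "(\<lambda>\<rho>. (b(r0 := N)) \<rho> - c j \<rho>) = b'(r0 := N - c j r0)" for N
        by (auto simp: b'_def)
      note split = card_nat_sols_split[OF insert.prems(2) 5(3,4) ij fin,
          folded cj_def ci_def, unfolded b']
      have fin_ci: "finite (nat_sols I (insert r (insert r0 R)) ci (b'(r0 := N)))" for N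
        using split(2)[of "N + c j r0"] by simp
      have "?k cj < ?k c" "?k ci < ?k c"
        using 5 ij by (auto intro!: psubset_card_mono simp: cj_def ci_def)
      moreover have "- int q \<le> cj k r \<and> cj k r \<le> int p" "- int q \<le> ci k r \<and> ci k r \<le> int p"
        "cj k r0 \<ge> 0" "ci k r0 \<ge> 0" if "k \<in> I" for k
        using bd[OF that] c0[OF that] c0[OF 5(3)] c0[OF 5(4)] 5 by (auto simp: cj_def ci_def)
      ultimately have "(\<lambda>N. int (card (nat_sols I (insert r (insert r0 R)) cj (b(r0 := N))))) \<in> QP_eventually"
        "(\<lambda>N. int (card (nat_sols I (insert r (insert r0 R)) ci (b'(r0 := N))))) \<in> QP_eventually"
        using split(1) fin_ci by (auto intro!: less.hyps)
      then have "(\<lambda>N. int (card (nat_sols I (insert r (insert r0 R)) cj (b(r0 := N)))) +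
        int (card (nat_sols I (insert r (insert r0 R)) ci (b'(r0 := N - c j r0))))) \<in> QP_eventually"
        by (intro QP_eventually_add QP_eventually_shift[where f = "\<lambda>N. int (card (nat_sols I _ ci (b'(r0 := N))))"])
      then show ?thesis by (simp add: split(3))
    qed
  qed
  note main = this
  define M where "M = (\<Sum>i\<in>I. nat \<bar>c i r\<bar>)"
  have M: "- int M \<le> c i r \<and> c i r \<le> int M" if "i \<in> I" for i
  proof -
    have "nat \<bar>c i r\<bar> \<le> M"
      unfolding M_def using that by (intro member_le_sum) auto
    then show ?thesis by linarith
  qed
  show ?case
    unfolding rows
  proof (rule main[of c M M b])
    show "finite (nat_sols I (insert r (insert r0 R)) c (b(r0 := N)))" for N
      using insert.prems(4) unfolding rows .
  qed (use insert.prems(3) M in auto)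
qed

section \<open>Systems over base-\<open>n\<close> digits\<close>

text \<open>A bound y i < n becomes an equation through the complementary digit n - 1 - y i, and the
  terms \<open>n * q r\<close> move to the left. Row \<open>None\<close>, which fixes the value of
  the unknown n, is then the only row with a varying right-hand side.\<close>

lemma QP_eventually_card_box_sols:
  fixes c :: "'i \<Rightarrow> 'r \<Rightarrow> int"
  assumes I: "finite I" and R: "finite R"
  shows "(\<lambda>n. int (card {y :: 'i \<Rightarrow> nat. (\<forall>i. i \<notin> I \<longrightarrow> y i = 0) \<and> (\<forall>i\<in>I. int (y i) < n) \<and>
    (\<forall>r\<in>R. (\<Sum>i\<in>I. c i r * int (y i)) = p r + n * q r)})) \<in> QP_eventually"
proof -
  define Y where "Y n = {y :: 'i \<Rightarrow> nat. (\<forall>i. i \<notin> I \<longrightarrow> y i = 0) \<and> (\<forall>i\<in>I. int (y i) < n) \<and>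
    (\<forall>r\<in>R. (\<Sum>i\<in>I. c i r * int (y i)) = p r + n * q r)}" for n
  define I' :: "('i + 'i) option set" where "I' = insert None (Some ` (Inl ` I \<union> Inr ` I))"
  define R' :: "('r + 'i) option set" where "R' = Some ` (Inl ` R \<union> Inr ` I)"
  \<comment> \<open>The unknown \<open>None\<close> stands for \<open>n\<close>, and \<open>Some (Inr i)\<close> for \<open>n - 1 - y i\<close>.\<close>
  define C :: "('i + 'i) option \<Rightarrow> ('r + 'i) option \<Rightarrow> int" where
    "C x \<rho> = (case x of
        None \<Rightarrow> (case \<rho> of None \<Rightarrow> 1 | Some (Inl r) \<Rightarrow> - q r | Some (Inr i) \<Rightarrow> - 1)
      | Some (Inl i) \<Rightarrow> (case \<rho> of None \<Rightarrow> 0 | Some (Inl r) \<Rightarrow> c i r | Some (Inr k) \<Rightarrow> of_bool (i = k))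
      | Some (Inr i) \<Rightarrow> (case \<rho> of None \<Rightarrow> 0 | Some (Inl r) \<Rightarrow> 0 | Some (Inr k) \<Rightarrow> of_bool (i = k)))" for x \<rho>
  define b :: "('r + 'i) option \<Rightarrow> int" where
    "b \<rho> = (case \<rho> of None \<Rightarrow> 0 | Some (Inl r) \<Rightarrow> p r | Some (Inr i) \<Rightarrow> - 1)" for \<rho>
  define Z where "Z n = nat_sols I' (insert None R') C (b(None := n))" for n
  have sum_I': "(\<Sum>x\<in>I'. f x) = f None + (\<Sum>i\<in>I. f (Some (Inl i))) + (\<Sum>i\<in>I. f (Some (Inr i)))"
    for f :: "_ \<Rightarrow> int"
  proof -
    have "(\<Sum>x\<in>I'. f x) = f None + (\<Sum>x\<in>Inl ` I \<union> Inr ` I. f (Some x))"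
      unfolding I'_def using I by (subst sum.insert) (auto simp: sum.reindex)
    also have "(\<Sum>x\<in>Inl ` I \<union> Inr ` I. f (Some x)) = (\<Sum>i\<in>I. f (Some (Inl i))) + (\<Sum>i\<in>I. f (Some (Inr i)))"
      using I by (subst sum.union_disjoint) (auto simp: sum.reindex)
    finally show ?thesis by simp
  qed
  have delta: "(\<Sum>i\<in>I. of_bool (i = k) * f i) = f k" if "k \<in> I" for k and f :: "_ \<Rightarrow> int"
    using that I by (simp add: of_bool_def if_distrib[of "\<lambda>x. x * _"] cong: if_cong)
  have Z_iff: "z \<in> Z n \<longleftrightarrow> (\<forall>x. x \<notin> I' \<longrightarrow> z x = 0) \<and> int (z None) = n \<and>
      (\<forall>r\<in>R. (\<Sum>i\<in>I. c i r * int (z (Some (Inl i)))) = p r + n * q r) \<and>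
      (\<forall>i\<in>I. int (z (Some (Inl i))) + int (z (Some (Inr i))) = n - 1)" for z n
  proof -
    have "(\<forall>\<rho>\<in>insert None R'. (\<Sum>x\<in>I'. C x \<rho> * int (z x)) = (b(None := n)) \<rho>) \<longleftrightarrow>
      int (z None) = n \<and>
      (\<forall>r\<in>R. - q r * int (z None) + (\<Sum>i\<in>I. c i r * int (z (Some (Inl i)))) = p r) \<and>
      (\<forall>i\<in>I. - int (z None) + int (z (Some (Inl i))) + int (z (Some (Inr i))) = - 1)"
      by (simp add: R'_def sum_I' C_def b_def ball_Un delta)
    then show ?thesis
      unfolding Z_def nat_sols_def mem_Collect_eq by (auto simp: algebra_simps)
  qed
  define g where "g n y = (\<lambda>x. case x of None \<Rightarrow> nat n | Some (Inl i) \<Rightarrow> y i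
      | Some (Inr i) \<Rightarrow> if i \<in> I then nat (n - 1) - y i else 0)" for n and y :: "'i \<Rightarrow> nat"
  define h where "h z i = z (Some (Inl i))" for z :: "('i + 'i) option \<Rightarrow> nat" and i :: 'i
  have I'_iff: "None \<in> I'" "Some (Inl i) \<in> I' \<longleftrightarrow> i \<in> I" "Some (Inr i) \<in> I' \<longleftrightarrow> i \<in> I" for i
    by (auto simp: I'_def)
  have bij: "bij_betw h (Z n) (Y n)" if n: "n \<ge> 0" for n
  proof (rule bij_betw_byWitness[where f' = "g n"])
    show "\<forall>z\<in>Z n. g n (h z) = z"
    proof (intro ballI ext)
      fix z x assume z: "z \<in> Z n"
      then have sup: "\<And>x. x \<notin> I' \<Longrightarrow> z x = 0" and zn: "int (z None) = n"
        and zi: "\<And>i. i \<in> I \<Longrightarrow> int (z (Some (Inl i))) + int (z (Some (Inr i))) = n - 1"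
        unfolding Z_iff by auto
      show "g n (h z) x = z x"
      proof (cases x)
        case None
        then show ?thesis using zn by (simp add: g_def)
      next
        case (Some a)
        show ?thesis
        proof (cases a)
          case (Inl i)
          then show ?thesis using Some by (simp add: g_def h_def)
        next
          case (Inr i)
          then show ?thesis
            using zi[of i] sup[of "Some (Inr i)"] Some by (auto simp: g_def h_def I'_iff)
        qed
      qed
    qed
    show "\<forall>y\<in>Y n. h (g n y) = y"
      by (auto simp: h_def g_def fun_eq_iff)
    show "h ` Z n \<subseteq> Y n"
    proof safe
      fix z assume z: "z \<in> Z n"
      have "int (h z i) < n" if "i \<in> I" for i
      proof -
        have "int (z (Some (Inl i))) + int (z (Some (Inr i))) = n - 1"
          using z that unfolding Z_iff by blast
        then show ?thesis unfolding h_def by linarith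
      qed
      with z show "h z \<in> Y n"
        unfolding Z_iff Y_def by (auto simp: h_def I'_iff)
    qed
    show "g n ` Y n \<subseteq> Z n"
    proof safe
      fix y assume y: "y \<in> Y n"
      have sup: "g n y x = 0" if "x \<notin> I'" for x
        using that y by (cases x; cases "the x") (auto simp: g_def I'_iff Y_def)
      have "int (y i) + int (nat (n - 1) - y i) = n - 1" if "i \<in> I" for i
      proof -
        have "int (y i) < n" using y that by (auto simp: Y_def)
        then show ?thesis by linarith
      qed
      then show "g n y \<in> Z n"
        unfolding Z_iff using sup y n by (auto simp: Y_def g_def)
    qed
  qed
  have finY: "finite (Y n)" for n
    by (rule finite_subset[OF _ finite_set_of_finite_funs[OF I, of "{..nat n}" 0]])
      (auto simp: Y_def)
  \<comment> \<open>Finiteness is needed at every integer. For negative n no natural number can be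
    the value of the unknown \<open>None\<close>, so there is no solution.\<close>
  have finZ: "finite (Z n)" for n
  proof (cases "n \<ge> 0")
    case True
    then show ?thesis using bij finY bij_betw_finite by blast
  next
    case False
    then have "Z n = {}" by (auto simp: Z_iff)
    then show ?thesis by simp
  qed
  have "(\<lambda>n. int (card (Z n))) \<in> QP_eventually"
    unfolding Z_def
  proof (rule QP_eventually_card_nat_sols)
    show "finite R'" "None \<notin> R'" "finite I'"
      using I R by (auto simp: R'_def I'_def)
    show "C x None \<ge> 0" for x
      by (auto simp: C_def split: option.splits sum.splits)
    show "finite (nat_sols I' (insert None R') C (b(None := N)))" for N
      using finZ unfolding Z_def .
  qed
  then have "(\<lambda>n. int (card (Y n))) \<in> QP_eventually"
    by (rule QP_eventually_cong)
      (auto intro!: eventually_mono[OF eventually_ge_at_top[of 0]] bij_betw_same_card[OF bij])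
  then show ?thesis unfolding Y_def .
qed

text \<open>
  Since the carries are bounded independently of \<open>n\<close>, an equation whose coefficients are polynomials in \<open>n\<close>
  splits into finitely many systems with constant coefficients.
\<close>

lemma carries_exist:
  fixes n C :: int and L :: "nat \<Rightarrow> int"
  assumes n: "n \<ge> 2" and L: "\<And>e. e < E \<Longrightarrow> \<bar>L e\<bar> \<le> C * n" and C: "C \<ge> 0"
    and zero: "(\<Sum>e<E. L e * n ^ e) = 0"
  obtains \<gamma> where "\<gamma> 0 = 0" "\<gamma> E = 0" "\<And>e. e \<le> E \<Longrightarrow> \<bar>\<gamma> e\<bar> \<le> 2 * C"
    "\<And>e. e < E \<Longrightarrow> L e + \<gamma> e = n * \<gamma> (Suc e)"
proof -
  define \<gamma> where "\<gamma> = rec_nat 0 (\<lambda>e x. (L e + x) div n)"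
  have \<gamma>0: "\<gamma> 0 = 0" and \<gamma>_Suc: "\<gamma> (Suc e) = (L e + \<gamma> e) div n" for e
    by (auto simp: \<gamma>_def)
  \<comment> \<open>The invariant says that the carry together with all terms from position
    \<open>e\<close> on vanishes. Each later term has a further factor \<open>n\<close>, so
    \<open>n\<close> divides \<open>L e + \<gamma> e\<close> and the division defining the next
    carry is exact.\<close>
  have step: "L e + \<gamma> e = n * \<gamma> (Suc e)"
    if inv: "\<gamma> e * n ^ e + (\<Sum>i=e..<E. L i * n ^ i) = 0" and e: "e < E" for e
  proof -
    have "(\<Sum>i=e..<E. L i * n ^ i) = L e * n ^ e + (\<Sum>i=Suc e..<E. L i * n ^ i)"
      using e by (rule sum.atLeast_Suc_lessThan)
    also have "(\<Sum>i=Suc e..<E. L i * n ^ i) = n ^ Suc e * (\<Sum>i=Suc e..<E. L i * n ^ (i - Suc e))"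
      unfolding sum_distrib_left
    proof (intro sum.cong refl)
      fix i assume "i \<in> {Suc e..<E}"
      then have "n ^ i = n ^ Suc e * n ^ (i - Suc e)"
        by (subst power_add[symmetric]) auto
      then show "L i * n ^ i = n ^ Suc e * (L i * n ^ (i - Suc e))"
        by simp
    qed
    finally have "n ^ e * (L e + \<gamma> e + n * (\<Sum>i=Suc e..<E. L i * n ^ (i - Suc e))) = 0"
      using inv by (simp add: algebra_simps)
    then have "L e + \<gamma> e = n * - (\<Sum>i=Suc e..<E. L i * n ^ (i - Suc e))"
      using n by simp
    then have "n dvd L e + \<gamma> e" by simp
    then show ?thesis by (simp add: \<gamma>_Suc)
  qed
  have inv: "\<gamma> e * n ^ e + (\<Sum>i=e..<E. L i * n ^ i) = 0" if "e \<le> E" for e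
    using that
  proof (induction e)
    case 0
    then show ?case using zero by (simp add: \<gamma>0 lessThan_atLeast0)
  next
    case (Suc e)
    then have IH: "\<gamma> e * n ^ e + (\<Sum>i=e..<E. L i * n ^ i) = 0" by simp
    have "\<gamma> (Suc e) * n ^ Suc e = (L e + \<gamma> e) * n ^ e"
      using step[OF IH] Suc.prems by simp
    moreover have "(\<Sum>i=e..<E. L i * n ^ i) = L e * n ^ e + (\<Sum>i=Suc e..<E. L i * n ^ i)"
      using Suc.prems by (intro sum.atLeast_Suc_lessThan) auto
    ultimately show ?case using IH by (simp add: algebra_simps)
  qed
  have rec: "L e + \<gamma> e = n * \<gamma> (Suc e)" if "e < E" for e
    using step inv that by simp
  \<comment> \<open>The bound 2 C reproduces itself: (C n + 2 C) / n \<le> 2 C as soon as n \<ge>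
    2.\<close>
  have bound: "\<bar>\<gamma> e\<bar> \<le> 2 * C" if "e \<le> E" for e
    using that
  proof (induction e)
    case 0
    then show ?case using C by (simp add: \<gamma>0)
  next
    case (Suc e)
    have "n * \<bar>\<gamma> (Suc e)\<bar> = \<bar>L e + \<gamma> e\<bar>"
      using rec[of e] Suc.prems n by (simp add: abs_mult)
    also have "\<dots> \<le> C * n + 2 * C"
      using Suc L[of e] by simp
    also have "\<dots> \<le> n * (2 * C)"
      using mult_left_mono[OF n C] by (simp add: algebra_simps)
    finally show ?case using n by simp
  qed
  have "\<gamma> E = 0"
    using inv[of E] n by simp
  then show ?thesis
    using \<gamma>0 bound rec that by blast
qed

text \<open>The sum telescopes: its first m terms add up to
  \<open>\<gamma> m * n ^ m\<close>.\<close>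

lemma carries_imp_zero:
  fixes n :: int and L \<gamma> :: "nat \<Rightarrow> int"
  assumes "\<gamma> 0 = 0" "\<gamma> E = 0" "\<And>e. e < E \<Longrightarrow> L e + \<gamma> e = n * \<gamma> (Suc e)"
  shows "(\<Sum>e<E. L e * n ^ e) = 0"
proof -
  have "(\<Sum>e<m. L e * n ^ e) = \<gamma> m * n ^ m" if "m \<le> E" for m
    using that
  proof (induction m)
    case (Suc m)
    have "(\<Sum>e<Suc m. L e * n ^ e) = (L m + \<gamma> m) * n ^ m"
      using Suc by (simp add: algebra_simps)
    also have "\<dots> = \<gamma> (Suc m) * n ^ Suc m"
      using assms(3)[of m] Suc.prems by simp
    finally show ?case .
  qed (simp add: assms)
  from this[of E] show ?thesis using assms(2) by simp
qed

lemma poly_eq_sum_coeff: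
  fixes p :: "'a::comm_semiring_1 poly"
  assumes "degree p < E"
  shows "poly p x = (\<Sum>e<E. coeff p e * x ^ e)"
  unfolding poly_altdef using assms
  by (intro sum.mono_neutral_left) (auto simp: coeff_eq_0)

text \<open>The solutions are sorted by their carries. A solution determines its carries, so the
  classes are disjoint, and there are only finitely many carry patterns, the same for all n \<ge>
  2.\<close>

lemma QP_eventually_card_digit_sols:
  fixes A :: "'k \<Rightarrow> 'i \<Rightarrow> int poly" and B :: "'k \<Rightarrow> int poly"
  assumes I: "finite I" and K: "finite K"
  shows "(\<lambda>n. int (card {y :: 'i \<Rightarrow> nat. (\<forall>i. i \<notin> I \<longrightarrow> y i = 0) \<and> (\<forall>i\<in>I. int (y i) < n) \<and>
    (\<forall>k\<in>K. (\<Sum>i\<in>I. poly (A k i) n * int (y i)) = poly (B k) n)})) \<in> QP_eventually"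
proof -
  define D where "D n = {y :: 'i \<Rightarrow> nat. (\<forall>i. i \<notin> I \<longrightarrow> y i = 0) \<and> (\<forall>i\<in>I. int (y i) < n) \<and>
    (\<forall>k\<in>K. (\<Sum>i\<in>I. poly (A k i) n * int (y i)) = poly (B k) n)}" for n
  define E where "E = Suc (\<Sum>k\<in>K. degree (B k) + (\<Sum>i\<in>I. degree (A k i)))"
  have degB: "degree (B k) < E" and degA: "i \<in> I \<Longrightarrow> degree (A k i) < E" if "k \<in> K" for i k
  proof -
    have "degree (B k) + (\<Sum>i\<in>I. degree (A k i)) < E"
      unfolding E_def less_Suc_eq_le using K that
      by (intro member_le_sum[where f = "\<lambda>k. degree (B k) + (\<Sum>i\<in>I. degree (A k i))"]) auto
    moreover have "degree (A k i) \<le> (\<Sum>i\<in>I. degree (A k i))" if "i \<in> I"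
      using I that by (intro member_le_sum) auto
    ultimately show "degree (B k) < E" "i \<in> I \<Longrightarrow> degree (A k i) < E" by auto
  qed
  \<comment> \<open>A crude common bound: the sum of the absolute values of all coefficients
    occurring in the system.\<close>
  define C where "C = (\<Sum>k\<in>K. \<Sum>e<E. (\<Sum>i\<in>I. \<bar>coeff (A k i) e\<bar>) + \<bar>coeff (B k) e\<bar>)"
  define L where "L y k e = (\<Sum>i\<in>I. coeff (A k i) e * int (y i)) - coeff (B k) e"
    for y :: "'i \<Rightarrow> nat" and k e
  have C: "(\<Sum>i\<in>I. \<bar>coeff (A k i) e\<bar>) + \<bar>coeff (B k) e\<bar> \<le> C" if "k \<in> K" "e < E" for k e
  proof -
    have "(\<Sum>i\<in>I. \<bar>coeff (A k i) e\<bar>) + \<bar>coeff (B k) e\<bar> \<le>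
        (\<Sum>e<E. (\<Sum>i\<in>I. \<bar>coeff (A k i) e\<bar>) + \<bar>coeff (B k) e\<bar>)"
      using that by (intro member_le_sum[where f = "\<lambda>e. (\<Sum>i\<in>I. \<bar>coeff (A k i) e\<bar>) + \<bar>coeff (B k) e\<bar>"])
        (auto intro!: add_nonneg_nonneg sum_nonneg)
    also have "\<dots> \<le> C"
      unfolding C_def using that K
      by (intro member_le_sum[where f = "\<lambda>k. \<Sum>e<E. (\<Sum>i\<in>I. \<bar>coeff (A k i) e\<bar>) + \<bar>coeff (B k) e\<bar>"])
        (auto intro!: add_nonneg_nonneg sum_nonneg)
    finally show ?thesis .
  qed
  have C0: "C \<ge> 0"
    unfolding C_def by (auto intro!: add_nonneg_nonneg sum_nonneg)
  have L_bound: "\<bar>L y k e\<bar> \<le> C * n" if "k \<in> K" "e < E" "n \<ge> 1" "\<forall>i\<in>I. int (y i) < n" for y k e n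
  proof -
    have "\<bar>L y k e\<bar> \<le> (\<Sum>i\<in>I. \<bar>coeff (A k i) e * int (y i)\<bar>) + \<bar>coeff (B k) e\<bar>"
      unfolding L_def by (rule order_trans[OF abs_triangle_ineq4 add_right_mono[OF sum_abs]])
    also have "\<dots> \<le> (\<Sum>i\<in>I. \<bar>coeff (A k i) e\<bar> * n) + \<bar>coeff (B k) e\<bar> * n"
    proof (intro add_mono sum_mono)
      show "\<bar>coeff (A k i) e * int (y i)\<bar> \<le> \<bar>coeff (A k i) e\<bar> * n" if "i \<in> I" for i
        using \<open>\<forall>i\<in>I. int (y i) < n\<close> that by (auto simp: abs_mult less_imp_le intro!: mult_left_mono)
      show "\<bar>coeff (B k) e\<bar> \<le> \<bar>coeff (B k) e\<bar> * n"
        using \<open>n \<ge> 1\<close> mult_left_mono[of 1 n "\<bar>coeff (B k) e\<bar>"] by simp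
    qed
    also have "\<dots> = ((\<Sum>i\<in>I. \<bar>coeff (A k i) e\<bar>) + \<bar>coeff (B k) e\<bar>) * n"
      by (simp add: sum_distrib_right distrib_right)
    also have "\<dots> \<le> C * n"
      using C[OF that(1,2)] that(3) by (intro mult_right_mono) auto
    finally show ?thesis .
  qed
  have expand: "(\<Sum>i\<in>I. poly (A k i) n * int (y i)) = poly (B k) n \<longleftrightarrow> (\<Sum>e<E. L y k e * n ^ e) = 0"
    if "k \<in> K" for k n y
  proof -
    have "(\<Sum>i\<in>I. poly (A k i) n * int (y i)) = (\<Sum>i\<in>I. \<Sum>e<E. coeff (A k i) e * n ^ e * int (y i))"
      using that degA by (intro sum.cong) (auto simp: poly_eq_sum_coeff[of _ E] sum_distrib_right)
    also have "\<dots> = (\<Sum>e<E. (\<Sum>i\<in>I. coeff (A k i) e * int (y i)) * n ^ e)"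
      by (subst sum.swap) (simp add: sum_distrib_left mult_ac)
    finally show ?thesis
      using that degB[of k]
      by (simp add: L_def poly_eq_sum_coeff[of _ E] left_diff_distrib sum_subtractf)
  qed
  \<comment> \<open>The range is the bound from \<open>carries_exist\<close>. No carry enters the
    lowest position or leaves the highest one, and the value 0 off the index set keeps
    \<open>\<Gamma>\<close> finite.\<close>
  define \<Gamma> where "\<Gamma> = {\<gamma> :: 'k \<times> nat \<Rightarrow> int. (\<forall>x. (x \<in> K \<times> {..E} \<longrightarrow> \<gamma> x \<in> {-2*C..2*C}) \<and>
      (x \<notin> K \<times> {..E} \<longrightarrow> \<gamma> x = 0)) \<and> (\<forall>k\<in>K. \<gamma> (k, 0) = 0 \<and> \<gamma> (k, E) = 0)}"
  have fin\<Gamma>: "finite \<Gamma>"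
    by (rule finite_subset[OF _ finite_set_of_finite_funs[of "K \<times> {..E}" "{-2*C..2*C}" 0]])
      (use K in \<open>auto simp: \<Gamma>_def\<close>)
  \<comment> \<open>For fixed carries, the equation at each power of n has constant coefficients and
    a right-hand side affine in n, as \<open>QP_eventually_card_box_sols\<close> requires.\<close>
  define D\<gamma> where "D\<gamma> \<gamma> n = {y :: 'i \<Rightarrow> nat. (\<forall>i. i \<notin> I \<longrightarrow> y i = 0) \<and> (\<forall>i\<in>I. int (y i) < n) \<and>
    (\<forall>r\<in>K \<times> {..<E}. (\<Sum>i\<in>I. coeff (A (fst r) i) (snd r) * int (y i)) =
      (coeff (B (fst r)) (snd r) - \<gamma> r) + n * \<gamma> (fst r, Suc (snd r)))}" for \<gamma> n
  have D\<gamma>_iff: "y \<in> D\<gamma> \<gamma> n \<longleftrightarrow> (\<forall>i. i \<notin> I \<longrightarrow> y i = 0) \<and> (\<forall>i\<in>I. int (y i) < n) \<and>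
      (\<forall>k\<in>K. \<forall>e<E. L y k e + \<gamma> (k, e) = n * \<gamma> (k, Suc e))" for y \<gamma> n
    by (auto simp: D\<gamma>_def L_def algebra_simps)
  have un: "D n = (\<Union>\<gamma>\<in>\<Gamma>. D\<gamma> \<gamma> n)" if n: "n \<ge> 2" for n
  proof (intro equalityI subsetI)
    fix y assume y: "y \<in> D n"
    then have y': "\<forall>i. i \<notin> I \<longrightarrow> y i = 0" "\<forall>i\<in>I. int (y i) < n"
      by (auto simp: D_def)
    have "\<forall>k\<in>K. \<exists>\<gamma>. \<gamma> 0 = 0 \<and> \<gamma> E = 0 \<and> (\<forall>e\<le>E. \<bar>\<gamma> e\<bar> \<le> 2 * C) \<and>
        (\<forall>e<E. L y k e + \<gamma> e = n * \<gamma> (Suc e))"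
    proof
      fix k assume k: "k \<in> K"
      have zero: "(\<Sum>e<E. L y k e * n ^ e) = 0"
        using y k expand[OF k] by (auto simp: D_def)
      have bound: "\<And>e. e < E \<Longrightarrow> \<bar>L y k e\<bar> \<le> C * n"
        using L_bound[OF k] n y'(2) by simp
      obtain \<gamma> where "\<gamma> 0 = 0" "\<gamma> E = 0" "\<And>e. e \<le> E \<Longrightarrow> \<bar>\<gamma> e\<bar> \<le> 2 * C"
        "\<And>e. e < E \<Longrightarrow> L y k e + \<gamma> e = n * \<gamma> (Suc e)"
        using carries_exist[OF n bound C0 zero] by blast
      then show "\<exists>\<gamma>. \<gamma> 0 = 0 \<and> \<gamma> E = 0 \<and> (\<forall>e\<le>E. \<bar>\<gamma> e\<bar> \<le> 2 * C) \<and>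
          (\<forall>e<E. L y k e + \<gamma> e = n * \<gamma> (Suc e))"
        by blast
    qed
    then obtain \<gamma> where \<gamma>: "\<forall>k\<in>K. \<gamma> k 0 = 0 \<and> \<gamma> k E = 0 \<and> (\<forall>e\<le>E. \<bar>\<gamma> k e\<bar> \<le> 2 * C) \<and>
        (\<forall>e<E. L y k e + \<gamma> k e = n * \<gamma> k (Suc e))"
      by (auto simp: bchoice_iff)
    define \<gamma>' where "\<gamma>' = (\<lambda>(k, e). if k \<in> K \<and> e \<le> E then \<gamma> k e else 0)"
    have "\<gamma>' \<in> \<Gamma>"
      using \<gamma> by (auto simp: \<Gamma>_def \<gamma>'_def abs_le_iff minus_le_iff)
    moreover have "y \<in> D\<gamma> \<gamma>' n"
      using \<gamma> y' by (auto simp: D\<gamma>_iff \<gamma>'_def)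
    ultimately show "y \<in> (\<Union>\<gamma>\<in>\<Gamma>. D\<gamma> \<gamma> n)" by blast
  next
    fix y assume "y \<in> (\<Union>\<gamma>\<in>\<Gamma>. D\<gamma> \<gamma> n)"
    then obtain \<gamma> where \<gamma>: "\<gamma> \<in> \<Gamma>" and y: "y \<in> D\<gamma> \<gamma> n" by blast
    have "(\<Sum>e<E. L y k e * n ^ e) = 0" if k: "k \<in> K" for k
      using \<gamma> y k by (intro carries_imp_zero[of "\<lambda>e. \<gamma> (k, e)"]) (auto simp: D\<gamma>_iff \<Gamma>_def)
    then show "y \<in> D n"
      using y expand by (auto simp: D_def D\<gamma>_iff)
  qed
  \<comment> \<open>The carries are computed from \<open>y\<close> recursively, starting from 0,
    because n is nonzero. Two patterns shared by one \<open>y\<close> therefore agree.\<close>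
  have disj: "D\<gamma> \<gamma> n \<inter> D\<gamma> \<gamma>' n = {}" if n: "n \<ge> 2" and \<gamma>: "\<gamma> \<in> \<Gamma>" "\<gamma>' \<in> \<Gamma>" "\<gamma> \<noteq> \<gamma>'" for n \<gamma> \<gamma>'
  proof (rule ccontr)
    assume "\<not> ?thesis"
    then obtain y where y: "y \<in> D\<gamma> \<gamma> n" "y \<in> D\<gamma> \<gamma>' n" by blast
    have eq: "\<gamma> (k, e) = \<gamma>' (k, e)" if "k \<in> K" "e \<le> E" for k e
      using that(2)
    proof (induction e)
      case 0
      then show ?case using \<gamma> that(1) by (auto simp: \<Gamma>_def)
    next
      case (Suc e)
      then have "e < E" by simp
      then have "L y k e + \<gamma> (k, e) = n * \<gamma> (k, Suc e)" "L y k e + \<gamma>' (k, e) = n * \<gamma>' (k, Suc e)"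
        using y that(1) unfolding D\<gamma>_iff by blast+
      then have "n * \<gamma> (k, Suc e) = n * \<gamma>' (k, Suc e)"
        using Suc by auto
      then show ?case using n by simp
    qed
    have "\<gamma> x = \<gamma>' x" for x
    proof (cases "x \<in> K \<times> {..E}")
      case True
      then show ?thesis using eq by auto
    next
      case False
      then have "\<gamma> x = 0" "\<gamma>' x = 0"
        using \<gamma> unfolding \<Gamma>_def by blast+
      then show ?thesis by simp
    qed
    then show False using \<gamma>(3) by blast
  qed
  have finD: "finite (D\<gamma> \<gamma> n)" for \<gamma> n
    by (rule finite_subset[OF _ finite_set_of_finite_funs[OF I, of "{..<nat n}" 0]])
      (auto simp: D\<gamma>_iff zless_nat_eq_int_zless)
  have card: "int (card (D n)) = (\<Sum>\<gamma>\<in>\<Gamma>. int (card (D\<gamma> \<gamma> n)))" if "n \<ge> 2" for n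
    unfolding un[OF that] using fin\<Gamma> finD disj that by (subst card_UN_disjoint) auto
  have "(\<lambda>n. int (card (D\<gamma> \<gamma> n))) \<in> QP_eventually" for \<gamma>
    unfolding D\<gamma>_def using K I
    by (intro QP_eventually_card_box_sols[where c = "\<lambda>i r. coeff (A (fst r) i) (snd r)"]) auto
  then have "(\<lambda>n. \<Sum>\<gamma>\<in>\<Gamma>. int (card (D\<gamma> \<gamma> n))) \<in> QP_eventually"
    by (intro QP_eventually_sum)
  then have "(\<lambda>n. int (card (D n))) \<in> QP_eventually"
    by (rule QP_eventually_cong) (auto intro!: eventually_mono[OF eventually_ge_at_top[of 2]] simp: card)
  then show ?thesis unfolding D_def .
qed

section \<open>Digits of natural numbers in a fixed base\<close>

lemma digits_sum: "(\<Sum>l<m. (x div N ^ l mod N) * N ^ l) = x mod N ^ m" for x N :: nat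
proof (induction m)
  case (Suc m)
  have "x mod N ^ Suc m = N ^ m * (x div N ^ m mod N) + x mod N ^ m"
    by (simp add: mod_mult2_eq mult.commute[of N])
  then show ?case using Suc by simp
qed simp

lemma digits_sum_less:
  assumes "\<And>l. l < m \<Longrightarrow> y l < N"
  shows "(\<Sum>l<m. y l * N ^ l) < (N ^ m :: nat)"
  using assms
proof (induction m)
  case (Suc m)
  have "(\<Sum>l<Suc m. y l * N ^ l) < N ^ m + y m * N ^ m"
    using Suc by simp
  also have "\<dots> = Suc (y m) * N ^ m" by simp
  also have "\<dots> \<le> N * N ^ m"
    using Suc.prems[of m] by (intro mult_right_mono) auto
  finally show ?case by simp
qed simp

lemma digit_of_sum:
  fixes N :: nat
  assumes "\<And>l. l < m \<Longrightarrow> y l < N" "l < m"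
  shows "(\<Sum>l<m. y l * N ^ l) div N ^ l mod N = y l"
  using assms
proof (induction m arbitrary: y l)
  case (Suc m)
  have N: "N > 0" using Suc.prems by fastforce
  have "(\<Sum>l<Suc m. y l * N ^ l) = y 0 + N * (\<Sum>l<m. y (Suc l) * N ^ l)"
    by (subst sum.lessThan_Suc_shift) (simp add: sum_distrib_left algebra_simps)
  moreover have "(y 0 + N * x) div N = x" "(y 0 + N * x) mod N = y 0" for x
    using Suc.prems(1)[of 0] N by auto
  moreover have "(\<Sum>l<m. y (Suc l) * N ^ l) div N ^ k mod N = y (Suc k)" if "k < m" for k
    using Suc.IH[of "\<lambda>l. y (Suc l)" k] Suc.prems that by simp
  ultimately show ?case
    using Suc.prems(2) by (cases l) (auto simp: div_mult2_eq)
qed simp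

text \<open>Replacing each unknown by its \<open>m\<close> digits keeps the equations linear: digit
  \<open>l\<close> gets the old coefficient times n ^ l, which is again a polynomial in n.\<close>

lemma QP_eventually_card_bounded_sols:
  fixes A :: "'k \<Rightarrow> 'i \<Rightarrow> int poly" and B :: "'k \<Rightarrow> int poly"
  assumes I: "finite I" and K: "finite K"
  shows "(\<lambda>n. int (card {x :: 'i \<Rightarrow> nat. (\<forall>i. i \<notin> I \<longrightarrow> x i = 0) \<and> (\<forall>i\<in>I. int (x i) < n ^ m) \<and>
    (\<forall>k\<in>K. (\<Sum>i\<in>I. poly (A k i) n * int (x i)) = poly (B k) n)})) \<in> QP_eventually"
proof -
  define X where "X n = {x :: 'i \<Rightarrow> nat. (\<forall>i. i \<notin> I \<longrightarrow> x i = 0) \<and> (\<forall>i\<in>I. int (x i) < n ^ m) \<and>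
    (\<forall>k\<in>K. (\<Sum>i\<in>I. poly (A k i) n * int (x i)) = poly (B k) n)}" for n
  define Y where "Y n = {y :: 'i \<times> nat \<Rightarrow> nat. (\<forall>x. x \<notin> I \<times> {..<m} \<longrightarrow> y x = 0) \<and>
    (\<forall>x\<in>I \<times> {..<m}. int (y x) < n) \<and>
    (\<forall>k\<in>K. (\<Sum>x\<in>I \<times> {..<m}. poly (A k (fst x) * monom 1 (snd x)) n * int (y x)) = poly (B k) n)}" for n
  define f where "f n y i = (\<Sum>l<m. y (i, l) * nat n ^ l)" for n and y :: "'i \<times> nat \<Rightarrow> nat" and i
  define g where "g n x = (\<lambda>(i, l). if i \<in> I \<and> l < m then x i div nat n ^ l mod nat n else 0)"
    for n and x :: "'i \<Rightarrow> nat"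
  have sum_eq: "(\<Sum>x\<in>I \<times> {..<m}. poly (A k (fst x) * monom 1 (snd x)) n * int (y x)) =
      (\<Sum>i\<in>I. poly (A k i) n * int (f n y i))" if "n > 0" for n k y
    using that by (simp add: sum.cartesian_product' f_def sum_distrib_left poly_monom algebra_simps)
  have gf: "g n (f n y) = y" if "n > 0" "y \<in> Y n" for n y
  proof
    fix x :: "'i \<times> nat"
    obtain i l where x: "x = (i, l)" by (cases x)
    show "g n (f n y) x = y x"
    proof (cases "x \<in> I \<times> {..<m}")
      case True
      have "y (i, l) < nat n" if "l < m" for l
        using \<open>y \<in> Y n\<close> True x that by (force simp: Y_def zless_nat_eq_int_zless)
      then have "f n y i div nat n ^ l mod nat n = y (i, l)"
        unfolding f_def using True x by (intro digit_of_sum[where y = "\<lambda>l. y (i, l)"]) auto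
      then show ?thesis using True x by (simp add: g_def)
    next
      case False
      then show ?thesis using x that by (auto simp: g_def Y_def)
    qed
  qed
  have fg: "f n (g n x) = x" if "n > 0" "\<forall>i. i \<notin> I \<longrightarrow> x i = 0" "\<forall>i\<in>I. int (x i) < n ^ m" for n x
  proof
    fix i
    show "f n (g n x) i = x i"
    proof (cases "i \<in> I")
      case True
      have "x i < nat n ^ m"
        using that True by (metis nat_less_iff nat_int nat_power_eq of_nat_0_le_iff less_le zless_nat_eq_int_zless)
      then show ?thesis
        using True digits_sum[where N = "nat n" and x = "x i" and m = m] by (simp add: f_def g_def)
    qed (use that in \<open>simp add: f_def g_def\<close>)
  qed
  have bij: "bij_betw (f n) (Y n) (X n)" if n: "n > 0" for n
  proof (rule bij_betw_byWitness[where f' = "g n"])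
    show "\<forall>y\<in>Y n. g n (f n y) = y" using gf n by blast
    show "\<forall>x\<in>X n. f n (g n x) = x" using fg n by (auto simp: X_def)
    show "f n ` Y n \<subseteq> X n"
    proof safe
      fix y assume y: "y \<in> Y n"
      have "int (f n y i) < n ^ m" if "i \<in> I" for i
      proof -
        have "y (i, l) < nat n" if "l < m" for l
          using y \<open>i \<in> I\<close> that by (force simp: Y_def zless_nat_eq_int_zless)
        then have "f n y i < nat n ^ m"
          unfolding f_def by (rule digits_sum_less)
        then show ?thesis
          using n by (metis int_nat_eq less_le of_nat_less_iff of_nat_power)
      qed
      then show "f n y \<in> X n"
        using y sum_eq[OF n] by (auto simp: X_def Y_def f_def)
    qed
    show "g n ` X n \<subseteq> Y n"
    proof safe
      fix x assume x: "x \<in> X n"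
      have "f n (g n x) = x"
        using fg n x by (auto simp: X_def)
      moreover have "int (g n x a) < n" for a
        using n by (cases a) (auto simp: g_def zless_nat_eq_int_zless[symmetric])
      moreover have "g n x a = 0" if "a \<notin> I \<times> {..<m}" for a
        using that by (auto simp: g_def split: prod.splits)
      ultimately show "g n x \<in> Y n"
        using x sum_eq[OF n, of _ "g n x"] unfolding Y_def X_def mem_Collect_eq
        by (auto simp del: poly_mult)
    qed
  qed
  have "(\<lambda>n. int (card (Y n))) \<in> QP_eventually"
    unfolding Y_def using I K
    by (intro QP_eventually_card_digit_sols[where A = "\<lambda>k x. A k (fst x) * monom 1 (snd x)"]) auto
  then have "(\<lambda>n. int (card (X n))) \<in> QP_eventually"
    by (rule QP_eventually_cong)
      (auto intro!: eventually_mono[OF eventually_gt_at_top[of 0]] bij_betw_same_card[OF bij])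
  then show ?thesis unfolding X_def .
qed

section \<open>Inequalities with polynomial coefficients\<close>

text \<open>The bound is a pure power of n because its exponent serves as a number of digits;
  constant factors go into the exponent.\<close>

definition poly_bounded :: "(int \<Rightarrow> int) \<Rightarrow> bool" where
  "poly_bounded f \<longleftrightarrow> (\<exists>m. eventually (\<lambda>n. \<bar>f n\<bar> \<le> n ^ m) at_top)"

section \<open>Closure of polynomial growth under arithmetic\<close>

lemma poly_bounded_const: "poly_bounded (\<lambda>n. c)"
  unfolding poly_bounded_def
  by (intro exI[of _ 1]) (auto intro: eventually_mono[OF eventually_ge_at_top[of "\<bar>c\<bar>"]])

lemma poly_bounded_id: "poly_bounded (\<lambda>n. n)"
  unfolding poly_bounded_def
  by (intro exI[of _ 1]) (auto intro: eventually_mono[OF eventually_ge_at_top[of 0]])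

lemma poly_bounded_mult:
  assumes "poly_bounded f" "poly_bounded g"
  shows "poly_bounded (\<lambda>n. f n * g n)"
proof -
  obtain k m where "eventually (\<lambda>n. \<bar>f n\<bar> \<le> n ^ k) at_top" "eventually (\<lambda>n. \<bar>g n\<bar> \<le> n ^ m) at_top"
    using assms unfolding poly_bounded_def by blast
  then have "eventually (\<lambda>n. \<bar>f n * g n\<bar> \<le> n ^ (k + m)) at_top"
    using eventually_ge_at_top[of 0]
    by eventually_elim (auto simp: abs_mult power_add intro!: mult_mono)
  then show ?thesis unfolding poly_bounded_def by blast
qed

lemma poly_bounded_add:
  assumes "poly_bounded f" "poly_bounded g"
  shows "poly_bounded (\<lambda>n. f n + g n)"
proof -
  obtain k m where "eventually (\<lambda>n. \<bar>f n\<bar> \<le> n ^ k) at_top" "eventually (\<lambda>n. \<bar>g n\<bar> \<le> n ^ m) at_top"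
    using assms unfolding poly_bounded_def by blast
  then have "eventually (\<lambda>n. \<bar>f n + g n\<bar> \<le> n ^ Suc (k + m)) at_top"
    using eventually_ge_at_top[of 2]
  proof eventually_elim
    case (elim n)
    have "n ^ k \<le> n ^ (k + m)" "n ^ m \<le> n ^ (k + m)"
      using elim by (auto intro!: power_increasing)
    then have "\<bar>f n + g n\<bar> \<le> 2 * n ^ (k + m)"
      using elim by linarith
    also have "\<dots> \<le> n ^ Suc (k + m)"
      using elim by (auto intro!: mult_right_mono)
    finally show ?case .
  qed
  then show ?thesis unfolding poly_bounded_def by blast
qed

lemma poly_bounded_sum:
  assumes "\<And>x. x \<in> X \<Longrightarrow> poly_bounded (f x)"
  shows "poly_bounded (\<lambda>n. \<Sum>x\<in>X. f x n)"
  using assms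
  by (induction X rule: infinite_finite_induct) (auto intro: poly_bounded_const poly_bounded_add)

lemma poly_bounded_abs: "poly_bounded f \<Longrightarrow> poly_bounded (\<lambda>n. \<bar>f n\<bar>)"
  unfolding poly_bounded_def by simp

lemma poly_bounded_power: "poly_bounded f \<Longrightarrow> poly_bounded (\<lambda>n. f n ^ m)"
  by (induction m) (auto intro: poly_bounded_const poly_bounded_mult)

lemma poly_bounded_poly: "poly_bounded (poly p)"
proof (induction p)
  case (pCons a p)
  have "poly_bounded (\<lambda>n. a + n * poly p n)"
    using pCons by (intro poly_bounded_add poly_bounded_mult poly_bounded_const poly_bounded_id)
  then show ?case by (simp add: poly_bounded_def)
qed (auto simp: poly_bounded_def intro!: exI[of _ 0])

lemma QP_eventually_card_ineq_sols:
  fixes a :: "'k \<Rightarrow> 'j \<Rightarrow> int poly" and b :: "'k \<Rightarrow> int poly"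
  assumes J: "finite J" and K: "finite K"
  defines "X \<equiv> \<lambda>n. {x :: 'j \<Rightarrow> int. (\<forall>j. j \<notin> J \<longrightarrow> x j = 0) \<and>
    (\<forall>k\<in>K. (\<Sum>j\<in>J. poly (a k j) n * x j) \<le> poly (b k) n)}"
  assumes bounded: "eventually (\<lambda>n. \<forall>x\<in>X n. \<forall>j\<in>J. \<bar>x j\<bar> \<le> n ^ m) at_top"
  shows "(\<lambda>n. int (card (X n))) \<in> QP_eventually"
proof -
  define I :: "('j + 'k) set" where "I = Inl ` J \<union> Inr ` K"
  define A :: "'k \<Rightarrow> 'j + 'k \<Rightarrow> int poly" where
    "A k i = (case i of Inl j \<Rightarrow> a k j | Inr k' \<Rightarrow> of_bool (k = k'))" for k i
  \<comment> \<open>The nonnegative unknown for \<open>x j\<close> is \<open>x j + n ^ m\<close>;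
    the sum added to \<open>b k\<close> compensates for this shift.\<close>
  define B where "B k = b k + (\<Sum>j\<in>J. a k j * monom 1 m)" for k
  define slack where "slack n x k = poly (b k) n - (\<Sum>j\<in>J. poly (a k j) n * x j)" for n x k
  \<comment> \<open>\<open>H n\<close> exceeds every shifted unknown, which is at most
    \<open>2 * n ^ m\<close>, and every slack, which is bounded because \<bar>x j\<bar> \<le> n ^ m.
    The leading 1 makes the comparison strict.\<close>
  define H where "H n = 1 + 2 * n ^ m + (\<Sum>k\<in>K. \<bar>poly (b k) n\<bar> + (\<Sum>j\<in>J. \<bar>poly (a k j) n\<bar> * n ^ m))" for n
  have "poly_bounded H"
    unfolding H_def
    by (intro poly_bounded_add poly_bounded_mult poly_bounded_const poly_bounded_sum poly_bounded_abs
        poly_bounded_poly poly_bounded_power poly_bounded_id)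
  then obtain M where M: "eventually (\<lambda>n. \<bar>H n\<bar> \<le> n ^ M) at_top"
    unfolding poly_bounded_def by blast
  define Z where "Z n = {z :: 'j + 'k \<Rightarrow> nat. (\<forall>i. i \<notin> I \<longrightarrow> z i = 0) \<and> (\<forall>i\<in>I. int (z i) < n ^ M) \<and>
    (\<forall>k\<in>K. (\<Sum>i\<in>I. poly (A k i) n * int (z i)) = poly (B k) n)}" for n
  have sum_I: "(\<Sum>i\<in>I. f i) = (\<Sum>j\<in>J. f (Inl j)) + (\<Sum>k\<in>K. f (Inr k))" for f :: "_ \<Rightarrow> int"
    unfolding I_def using J K by (subst sum.union_disjoint) (auto simp: sum.reindex)
  have delta: "(\<Sum>k'\<in>K. poly (of_bool (k = k')) n * f k') = f k" if "k \<in> K" for k n and f :: "_ \<Rightarrow> int"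
    using that K by (simp add: of_bool_def if_distrib[of "\<lambda>p. poly p _ * _"] cong: if_cong)
  have sum_A: "(\<Sum>i\<in>I. poly (A k i) n * int (z i)) = poly (B k) n \<longleftrightarrow>
      (\<Sum>j\<in>J. poly (a k j) n * (int (z (Inl j)) - n ^ m)) + int (z (Inr k)) = poly (b k) n"
    if "k \<in> K" for k n z
  proof -
    have "(\<Sum>i\<in>I. poly (A k i) n * int (z i)) = (\<Sum>j\<in>J. poly (a k j) n * int (z (Inl j))) + int (z (Inr k))"
      using that by (simp add: sum_I A_def delta)
    moreover have "poly (B k) n = poly (b k) n + (\<Sum>j\<in>J. poly (a k j) n * n ^ m)"
      by (simp add: B_def poly_sum poly_monom)
    moreover have "(\<Sum>j\<in>J. poly (a k j) n * (int (z (Inl j)) - n ^ m)) =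
        (\<Sum>j\<in>J. poly (a k j) n * int (z (Inl j))) - (\<Sum>j\<in>J. poly (a k j) n * n ^ m)"
      by (simp add: right_diff_distrib sum_subtractf)
    ultimately show ?thesis by linarith
  qed
  define g where "g n x = (\<lambda>i. case i of Inl j \<Rightarrow> if j \<in> J then nat (x j + n ^ m) else 0
      | Inr k \<Rightarrow> if k \<in> K then nat (slack n x k) else 0)" for n x
  define h where "h n z j = (if j \<in> J then int (z (Inl j)) - n ^ m else 0)"
    for n and z :: "'j + 'k \<Rightarrow> nat" and j
  have card_eq: "eventually (\<lambda>n. int (card (Z n)) = int (card (X n))) at_top"
    using bounded M eventually_ge_at_top[of 1]
  proof eventually_elim
    case (elim n)
    have Z_iff: "z \<in> Z n \<longleftrightarrow> (\<forall>i. i \<notin> I \<longrightarrow> z i = 0) \<and> (\<forall>i\<in>I. int (z i) < n ^ M) \<and>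
        (\<forall>k\<in>K. slack n (h n z) k = int (z (Inr k)))" for z
    proof -
      have "(\<Sum>j\<in>J. poly (a k j) n * h n z j) = (\<Sum>j\<in>J. poly (a k j) n * (int (z (Inl j)) - n ^ m))" for k
        by (intro sum.cong) (auto simp: h_def)
      then show ?thesis
        unfolding Z_def slack_def by (auto simp: sum_A)
    qed
    have X_iff: "x \<in> X n \<longleftrightarrow> (\<forall>j. j \<notin> J \<longrightarrow> x j = 0) \<and> (\<forall>k\<in>K. slack n x k \<ge> 0)" for x
      by (simp add: X_def slack_def)
    have pos: "n ^ m \<ge> 0" using elim by simp
    have K_bound: "0 \<le> \<bar>poly (b k) n\<bar> + (\<Sum>j\<in>J. \<bar>poly (a k j) n\<bar> * n ^ m)" for k
      using pos by (intro add_nonneg_nonneg sum_nonneg mult_nonneg_nonneg) auto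
    have sumK: "0 \<le> (\<Sum>k\<in>K. \<bar>poly (b k) n\<bar> + (\<Sum>j\<in>J. \<bar>poly (a k j) n\<bar> * n ^ m))"
      using K_bound by (intro sum_nonneg)
    have x_bound: "- (n ^ m) \<le> x j" "x j + n ^ m < n ^ M" if "x \<in> X n" "j \<in> J" for x j
    proof -
      have "\<bar>x j\<bar> \<le> n ^ m" using elim that by blast
      then show "- (n ^ m) \<le> x j" "x j + n ^ m < n ^ M"
        using elim sumK unfolding H_def by linarith+
    qed
    have slack_bound: "slack n x k < n ^ M" if "x \<in> X n" "k \<in> K" for x k
    proof -
      have "slack n x k \<le> \<bar>poly (b k) n\<bar> + (\<Sum>j\<in>J. \<bar>poly (a k j) n * x j\<bar>)"
        unfolding slack_def using sum_abs[of "\<lambda>j. poly (a k j) n * x j" J] by linarith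
      also have "\<dots> \<le> \<bar>poly (b k) n\<bar> + (\<Sum>j\<in>J. \<bar>poly (a k j) n\<bar> * n ^ m)"
        using elim that by (intro add_left_mono sum_mono) (auto simp: abs_mult intro!: mult_left_mono)
      also have "\<dots> \<le> (\<Sum>k\<in>K. \<bar>poly (b k) n\<bar> + (\<Sum>j\<in>J. \<bar>poly (a k j) n\<bar> * n ^ m))"
        using K that K_bound
        by (intro member_le_sum[where f = "\<lambda>k. \<bar>poly (b k) n\<bar> + (\<Sum>j\<in>J. \<bar>poly (a k j) n\<bar> * n ^ m)"]) auto
      finally show ?thesis
        using elim pos unfolding H_def by linarith
    qed
    have hg: "h n (g n x) = x" if "x \<in> X n" for x
    proof
      fix j
      show "h n (g n x) j = x j"
        using that x_bound(1)[OF that, of j] by (auto simp: h_def g_def X_iff)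
    qed
    have "bij_betw (h n) (Z n) (X n)"
    proof (rule bij_betw_byWitness[where f' = "g n"])
      show "\<forall>z\<in>Z n. g n (h n z) = z"
      proof (intro ballI ext)
        fix z i assume z: "z \<in> Z n"
        show "g n (h n z) i = z i"
        proof (cases i)
          case (Inl j)
          then show ?thesis using z by (auto simp: g_def h_def Z_iff I_def)
        next
          case (Inr k)
          then show ?thesis using z by (auto simp: g_def Z_iff I_def)
        qed
      qed
      show "\<forall>x\<in>X n. h n (g n x) = x" using hg by blast
      show "h n ` Z n \<subseteq> X n"
        by (auto simp: Z_iff X_iff h_def)
      show "g n ` X n \<subseteq> Z n"
      proof safe
        fix x assume x: "x \<in> X n"
        have "g n x i = 0" if "i \<notin> I" for i
          using that by (cases i) (auto simp: g_def I_def)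
        moreover have "int (g n x i) < n ^ M" if "i \<in> I" for i
          using that x x_bound[OF x] slack_bound[OF x]
          by (cases i) (force simp: g_def I_def X_iff)+
        moreover have "slack n x k = int (g n x (Inr k))" if "k \<in> K" for k
          using x that by (simp add: g_def X_iff)
        ultimately show "g n x \<in> Z n"
          unfolding Z_iff hg[OF x] by blast
      qed
    qed
    then show ?case by (simp add: bij_betw_same_card)
  qed
  have "(\<lambda>n. int (card (Z n))) \<in> QP_eventually"
    unfolding Z_def using J K by (intro QP_eventually_card_bounded_sols) (auto simp: I_def)
  then show ?thesis
    using card_eq by (rule QP_eventually_cong)
qed

section \<open>Fourier--Motzkin elimination\<close>

text \<open>Horner induction with integer values: once \<open>poly p n\<close> has a fixed sign, its
  absolute value is at least 1, so \<open>n * poly p n\<close> outweighs the constant term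
  \<open>a\<close> for n > \<bar>a\<bar>.\<close>

lemma eventually_poly_pos_or_neg:
  fixes p :: "int poly"
  assumes "p \<noteq> 0"
  shows "eventually (\<lambda>n. poly p n > 0) at_top \<or> eventually (\<lambda>n. poly p n < 0) at_top"
  using assms
proof (induction p)
  case (pCons a p)
  show ?case
  proof (cases "p = 0")
    case True
    then show ?thesis using pCons.hyps by (cases "a > 0") auto
  next
    case False
    then consider "eventually (\<lambda>n. poly p n > 0) at_top" | "eventually (\<lambda>n. poly p n < 0) at_top"
      using pCons.IH by blast
    then show ?thesis
    proof cases
      case 1
      then have "eventually (\<lambda>n. poly (pCons a p) n > 0) at_top"
        using eventually_gt_at_top[of "\<bar>a\<bar>"]
      proof eventually_elim
        case (elim n)
        have "n * 1 \<le> n * poly p n"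
          using elim by (intro mult_left_mono) auto
        then show ?case using elim by simp
      qed
      then show ?thesis ..
    next
      case 2
      then have "eventually (\<lambda>n. poly (pCons a p) n < 0) at_top"
        using eventually_gt_at_top[of "\<bar>a\<bar>"]
      proof eventually_elim
        case (elim n)
        have "n * poly p n \<le> n * (- 1)"
          using elim by (intro mult_left_mono) auto
        then show ?case using elim by simp
      qed
      then show ?thesis ..
    qed
  qed
qed simp

lemma eventually_poly_nonzero:
  fixes p :: "int poly"
  assumes "p \<noteq> 0"
  shows "eventually (\<lambda>n. poly p n \<noteq> 0) at_top"
  using eventually_poly_pos_or_neg[OF assms] by (auto elim: eventually_mono)

text \<open>For choosing the eliminated variable between its lower bounds \<open>L\<close> and its
  upper bounds \<open>U\<close>, either of which may be empty.\<close>

lemma finite_sets_separated: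
  fixes L U :: "'a::linorder set"
  assumes "finite L" "finite U" "\<And>l u. l \<in> L \<Longrightarrow> u \<in> U \<Longrightarrow> l \<le> u"
  shows "\<exists>t. (\<forall>l\<in>L. l \<le> t) \<and> (\<forall>u\<in>U. t \<le> u)"
proof (cases "L = {}")
  case True
  then show ?thesis
    using assms by (cases "U = {}") (auto intro!: exI[of _ "Min U"])
next
  case False
  then show ?thesis
    using assms by (intro exI[of _ "Max L"]) auto
qed

text \<open>There is no constant term, so combining two constraints only combines coefficient
  functions. Constants enter later through a variable with value 1.\<close>

definition lin :: "'v set \<Rightarrow> ('v \<Rightarrow> int poly) \<Rightarrow> int \<Rightarrow> ('v \<Rightarrow> real) \<Rightarrow> real" where
  "lin V a n x = (\<Sum>v\<in>V. of_int (poly (a v) n) * x v)"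

lemma lin_comb: "lin V (\<lambda>v. p * a v - q * b v) n x =
    of_int (poly p n) * lin V a n x - of_int (poly q n) * lin V b n x"
  by (simp add: lin_def sum_distrib_left left_diff_distrib sum_subtractf mult.assoc)

text \<open>
  Nonzero polynomials have a constant sign for large \<open>n\<close>, so the case distinction on the sign of the
  coefficients of the eliminated variable does not depend on \<open>n\<close>.
\<close>

lemma fourier_motzkin_step:
  fixes C :: "(('v \<Rightarrow> int poly) \<times> ('w \<Rightarrow> int poly)) set"
  assumes C: "finite C"
  shows "\<exists>C'. finite C' \<and> eventually (\<lambda>n. \<forall>x y.
    (\<exists>t. \<forall>(a, c)\<in>C. lin V a n x + lin W c n y + of_int (poly (c k) n) * t \<le> 0) \<longleftrightarrow>
    (\<forall>(a, c)\<in>C'. lin V a n x + lin W c n y \<le> 0)) at_top"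
proof -
  define P where "P = {(a, c)\<in>C. eventually (\<lambda>n. poly (c k) n > 0) at_top}"
  define N where "N = {(a, c)\<in>C. eventually (\<lambda>n. poly (c k) n < 0) at_top}"
  define Z where "Z = {(a, c)\<in>C. c k = 0}"
  \<comment> \<open>The row with negative coefficient is multiplied by \<open>c k\<close> and the
    one with positive coefficient by \<open>- c' k\<close>. Both factors are positive for large n,
    \<open>t\<close> cancels, and no division leaves the ring of integer polynomials.\<close>
  define comb where "comb = (\<lambda>((a, c), (a', c')).
    ((\<lambda>v. c k * a' v - c' k * a v) :: 'v \<Rightarrow> int poly, (\<lambda>w. c k * c' w - c' k * c w) :: 'w \<Rightarrow> int poly))"
  define C' where "C' = Z \<union> comb ` (P \<times> N)"
  have fin: "finite P" "finite N" "finite Z"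
    using C by (auto simp: P_def N_def Z_def intro: finite_subset[OF _ C])
  have C_eq: "C = P \<union> N \<union> Z"
    using eventually_poly_pos_or_neg by (fastforce simp: P_def N_def Z_def)
  have "eventually (\<lambda>n. \<forall>r\<in>P. poly (snd r k) n > 0) at_top"
    "eventually (\<lambda>n. \<forall>r\<in>N. poly (snd r k) n < 0) at_top"
    by (intro eventually_ball_finite fin ballI; auto simp: P_def N_def)+
  then have "eventually (\<lambda>n. \<forall>x y.
    (\<exists>t. \<forall>(a, c)\<in>C. lin V a n x + lin W c n y + of_int (poly (c k) n) * t \<le> 0) \<longleftrightarrow>
    (\<forall>(a, c)\<in>C'. lin V a n x + lin W c n y \<le> 0)) at_top"
  proof eventually_elim
    case (elim n)
    show ?case
    proof (intro allI)
      fix x :: "'v \<Rightarrow> real" and y :: "'w \<Rightarrow> real"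
      define f where "f = (\<lambda>(a, c). lin V a n x + lin W c n y)"
      define d where "d = (\<lambda>(a :: 'v \<Rightarrow> int poly, c :: 'w \<Rightarrow> int poly). real_of_int (poly (c k) n))"
      have dP: "d r > 0" if "r \<in> P" for r
        using elim(1) that by (auto simp: d_def case_prod_unfold)
      have dN: "d r < 0" if "r \<in> N" for r
        using elim(2) that by (auto simp: d_def case_prod_unfold)
      have dZ: "d r = 0" if "r \<in> Z" for r
        using that by (auto simp: d_def Z_def)
      have f_comb: "f (comb (r, r')) = d r * f r' - d r' * f r" for r r'
        by (cases r; cases r') (simp add: f_def d_def comb_def lin_comb, simp add: algebra_simps)
      have lhs: "(\<forall>(a, c)\<in>C. lin V a n x + lin W c n y + of_int (poly (c k) n) * t \<le> 0) \<longleftrightarrow>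
          (\<forall>r\<in>C. f r + d r * t \<le> 0)" for t
        by (simp add: f_def d_def case_prod_unfold)
      have rhs: "(\<forall>(a, c)\<in>C'. lin V a n x + lin W c n y \<le> 0) \<longleftrightarrow>
          (\<forall>r\<in>Z. f r \<le> 0) \<and> (\<forall>r\<in>P. \<forall>r'\<in>N. d r * f r' - d r' * f r \<le> 0)"
      proof -
        have "(\<forall>(a, c)\<in>C'. lin V a n x + lin W c n y \<le> 0) \<longleftrightarrow> (\<forall>r\<in>C'. f r \<le> 0)"
          by (simp add: f_def case_prod_unfold)
        also have "\<dots> \<longleftrightarrow> (\<forall>r\<in>Z. f r \<le> 0) \<and> (\<forall>r\<in>P. \<forall>r'\<in>N. f (comb (r, r')) \<le> 0)"
          unfolding C'_def by blast
        finally show ?thesis unfolding f_comb .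
      qed
      have "(\<exists>t. \<forall>r\<in>C. f r + d r * t \<le> 0) \<longleftrightarrow>
          (\<forall>r\<in>Z. f r \<le> 0) \<and> (\<forall>r\<in>P. \<forall>r'\<in>N. d r * f r' - d r' * f r \<le> 0)"
      proof
        assume "\<exists>t. \<forall>r\<in>C. f r + d r * t \<le> 0"
        then obtain t where t: "\<And>r. r \<in> C \<Longrightarrow> f r + d r * t \<le> 0" by blast
        have "d r * f r' - d r' * f r \<le> 0" if "r \<in> P" "r' \<in> N" for r r'
        proof -
          have "f r' + d r' * t \<le> 0" "f r + d r * t \<le> 0"
            using t that C_eq by blast+
          then have "d r * (f r' + d r' * t) \<le> 0" "d r' * (f r + d r * t) \<ge> 0"
            using dP[OF that(1)] dN[OF that(2)]
            by (auto intro: mult_nonneg_nonpos mult_nonpos_nonpos)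
          then show ?thesis by (simp add: algebra_simps)
        qed
        moreover have "f r \<le> 0" if "r \<in> Z" for r
          using t[of r] dZ[OF that] that C_eq by simp
        ultimately show "(\<forall>r\<in>Z. f r \<le> 0) \<and> (\<forall>r\<in>P. \<forall>r'\<in>N. d r * f r' - d r' * f r \<le> 0)"
          by blast
      next
        assume R: "(\<forall>r\<in>Z. f r \<le> 0) \<and> (\<forall>r\<in>P. \<forall>r'\<in>N. d r * f r' - d r' * f r \<le> 0)"
        \<comment> \<open>Solved for \<open>t\<close>, a row of \<open>N\<close> is a lower bound
          and a row of \<open>P\<close> an upper bound; the combined rows say that every lower bound
          is at most every upper bound.\<close>
        have "\<exists>t. (\<forall>l\<in>(\<lambda>r. - f r / d r) ` N. l \<le> t) \<and> (\<forall>u\<in>(\<lambda>r. - f r / d r) ` P. t \<le> u)"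
        proof (rule finite_sets_separated)
          fix l u assume "l \<in> (\<lambda>r. - f r / d r) ` N" "u \<in> (\<lambda>r. - f r / d r) ` P"
          then obtain r r' where r: "r \<in> P" "u = - f r / d r" and r': "r' \<in> N" "l = - f r' / d r'"
            by blast
          have "d r * f r' \<le> d r' * f r" using R r r' by simp
          then show "l \<le> u"
            using dP[OF r(1)] dN[OF r'(1)] unfolding r(2) r'(2) by (simp add: field_simps)
        qed (use fin in auto)
        then obtain t where t: "\<And>r. r \<in> N \<Longrightarrow> - f r / d r \<le> t" "\<And>r. r \<in> P \<Longrightarrow> t \<le> - f r / d r"
          by blast
        have "f r + d r * t \<le> 0" if "r \<in> C" for r
        proof -
          from that consider "r \<in> P" | "r \<in> N" | "r \<in> Z" using C_eq by blast
          then show ?thesis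
          proof cases
            case 1
            then show ?thesis using t(2)[of r] dP[of r] by (simp add: field_simps)
          next
            case 2
            then show ?thesis using t(1)[of r] dN[of r] by (simp add: field_simps)
          next
            case 3
            then show ?thesis using R dZ by simp
          qed
        qed
        then show "\<exists>t. \<forall>r\<in>C. f r + d r * t \<le> 0" by blast
      qed
      then show "(\<exists>t. \<forall>(a, c)\<in>C. lin V a n x + lin W c n y + of_int (poly (c k) n) * t \<le> 0) \<longleftrightarrow>
          (\<forall>(a, c)\<in>C'. lin V a n x + lin W c n y \<le> 0)"
        unfolding lhs rhs .
    qed
  qed
  moreover have "finite C'"
    using fin by (simp add: C'_def)
  ultimately show ?thesis by blast
qed

lemma fourier_motzkin:
  fixes C :: "(('v \<Rightarrow> int poly) \<times> ('w \<Rightarrow> int poly)) set"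
  assumes "finite W" "finite C"
  shows "\<exists>C'. finite C' \<and> eventually (\<lambda>n. \<forall>x.
    (\<exists>y. \<forall>(a, c)\<in>C. lin V a n x + lin W c n y \<le> 0) \<longleftrightarrow> (\<forall>a\<in>C'. lin V a n x \<le> 0)) at_top"
  using assms
proof (induction W arbitrary: C rule: finite_induct)
  case empty
  have "(\<exists>y. \<forall>(a, c)\<in>C. lin V a n x + lin {} c n y \<le> 0) \<longleftrightarrow> (\<forall>a\<in>fst ` C. lin V a n x \<le> 0)" for n x
    by (auto simp: lin_def)
  then show ?case
    using empty by (intro exI[of _ "fst ` C"]) auto
next
  case (insert k W)
  obtain C1 where C1: "finite C1" and ev1: "eventually (\<lambda>n. \<forall>x y.
    (\<exists>t. \<forall>(a, c)\<in>C. lin V a n x + lin W c n y + of_int (poly (c k) n) * t \<le> 0) \<longleftrightarrow>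
    (\<forall>(a, c)\<in>C1. lin V a n x + lin W c n y \<le> 0)) at_top"
    using fourier_motzkin_step[OF insert.prems] by blast
  obtain C' where C': "finite C'" and ev2: "eventually (\<lambda>n. \<forall>x.
    (\<exists>y. \<forall>(a, c)\<in>C1. lin V a n x + lin W c n y \<le> 0) \<longleftrightarrow> (\<forall>a\<in>C'. lin V a n x \<le> 0)) at_top"
    using insert.IH[OF C1] by blast
  have split: "(\<exists>y. \<forall>(a, c)\<in>C. lin V a n x + lin (insert k W) c n y \<le> 0) \<longleftrightarrow>
      (\<exists>y t. \<forall>(a, c)\<in>C. lin V a n x + lin W c n y + of_int (poly (c k) n) * t \<le> 0)" for n x
  proof
    assume "\<exists>y. \<forall>(a, c)\<in>C. lin V a n x + lin (insert k W) c n y \<le> 0"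
    then obtain y where "\<forall>(a, c)\<in>C. lin V a n x + lin (insert k W) c n y \<le> 0" by blast
    then have "\<forall>(a, c)\<in>C. lin V a n x + lin W c n y + of_int (poly (c k) n) * y k \<le> 0"
      using insert.hyps by (simp add: lin_def algebra_simps)
    then show "\<exists>y t. \<forall>(a, c)\<in>C. lin V a n x + lin W c n y + of_int (poly (c k) n) * t \<le> 0" by blast
  next
    assume "\<exists>y t. \<forall>(a, c)\<in>C. lin V a n x + lin W c n y + of_int (poly (c k) n) * t \<le> 0"
    then obtain y t where yt: "\<forall>(a, c)\<in>C. lin V a n x + lin W c n y + of_int (poly (c k) n) * t \<le> 0" by blast
    have "lin (insert k W) c n (y(k := t)) = lin W c n y + of_int (poly (c k) n) * t" for c
    proof -
      have "lin W c n (y(k := t)) = lin W c n y"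
        unfolding lin_def using insert.hyps by (intro sum.cong) auto
      then show ?thesis
        using insert.hyps by (simp add: lin_def)
    qed
    with yt have "\<forall>(a, c)\<in>C. lin V a n x + lin (insert k W) c n (y(k := t)) \<le> 0"
      by (simp add: add.assoc)
    then show "\<exists>y. \<forall>(a, c)\<in>C. lin V a n x + lin (insert k W) c n y \<le> 0" by blast
  qed
  have "eventually (\<lambda>n. \<forall>x. (\<exists>y. \<forall>(a, c)\<in>C. lin V a n x + lin (insert k W) c n y \<le> 0) \<longleftrightarrow>
      (\<forall>a\<in>C'. lin V a n x \<le> 0)) at_top"
    using ev1 ev2 unfolding split by eventually_elim simp
  with C' show ?case by blast
qed

text \<open>The weights belong to indices instead of points, since the points \<open>p i\<close> may
  coincide for some n.\<close>

lemma convex_hull_image_finite: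
  fixes p :: "'i \<Rightarrow> 'a::real_vector"
  assumes "finite I"
  shows "convex hull (p ` I) = {x. \<exists>u. (\<forall>i\<in>I. 0 \<le> u i) \<and> sum u I = 1 \<and> (\<Sum>i\<in>I. u i *\<^sub>R p i) = x}"
    (is "_ = ?S")
proof
  show "?S \<subseteq> convex hull (p ` I)"
  proof safe
    fix u :: "'i \<Rightarrow> real" assume "\<forall>i\<in>I. 0 \<le> u i" "sum u I = 1"
    then show "(\<Sum>i\<in>I. u i *\<^sub>R p i) \<in> convex hull (p ` I)"
      by (intro convex_sum[OF assms convex_convex_hull]) (auto intro: hull_inc)
  qed
  show "convex hull (p ` I) \<subseteq> ?S"
  proof (rule hull_minimal)
    show "p ` I \<subseteq> ?S"
    proof safe
      fix i assume "i \<in> I"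
      then show "\<exists>u. (\<forall>i\<in>I. 0 \<le> u i) \<and> sum u I = 1 \<and> (\<Sum>i\<in>I. u i *\<^sub>R p i) = p i"
        using assms by (intro exI[of _ "\<lambda>j. of_bool (j = i)"])
          (auto simp: of_bool_def if_distrib[of "\<lambda>c. c *\<^sub>R _"] cong: if_cong)
    qed
    show "convex ?S"
    proof (rule convexI)
      fix x y :: 'a and a b :: real
      assume "x \<in> ?S" "y \<in> ?S" and ab: "0 \<le> a" "0 \<le> b" "a + b = 1"
      then obtain u w where u: "\<forall>i\<in>I. 0 \<le> u i" "sum u I = 1" "(\<Sum>i\<in>I. u i *\<^sub>R p i) = x"
        and w: "\<forall>i\<in>I. 0 \<le> w i" "sum w I = 1" "(\<Sum>i\<in>I. w i *\<^sub>R p i) = y" by blast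
      have "(\<forall>i\<in>I. 0 \<le> a * u i + b * w i)"
        using u(1) w(1) ab by simp
      moreover have "(\<Sum>i\<in>I. a * u i + b * w i) = 1"
        using u(2) w(2) ab by (simp add: sum.distrib sum_distrib_left[symmetric])
      moreover have "(\<Sum>i\<in>I. (a * u i + b * w i) *\<^sub>R p i) = a *\<^sub>R x + b *\<^sub>R y"
        by (simp add: u(3)[symmetric] w(3)[symmetric] scaleR_sum_right scaleR_add_left sum.distrib)
      ultimately show "a *\<^sub>R x + b *\<^sub>R y \<in> ?S"
        by (auto intro!: exI[of _ "\<lambda>i. a * u i + b * w i"])
    qed
  qed
qed

section \<open>Lattice points of the polytope\<close>

text \<open>Membership means that barycentric coordinates \<open>y\<close> exist. With denominators
  cleared this is a linear system in x and \<open>y\<close> over the integer polynomials, from which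
  \<open>y\<close> is eliminated.\<close>

lemma ratio_polytope_eventually_linear:
  fixes v w :: "nat \<Rightarrow> 'd::finite \<Rightarrow> int poly"
  assumes w_nonzero: "\<And>i j. i \<le> s \<Longrightarrow> w i j \<noteq> 0"
  shows "\<exists>C. finite C \<and> eventually (\<lambda>n. \<forall>x. x \<in> ratio_polytope s v w n \<longleftrightarrow>
    (\<forall>a\<in>C. lin UNIV a n (\<lambda>j. case j of None \<Rightarrow> 1 | Some j \<Rightarrow> x $ j) \<le> 0)) at_top"
proof -
  \<comment> \<open>\<open>W j\<close> is a common denominator for coordinate \<open>j\<close>, and
    \<open>u i j\<close> is the numerator of \<open>v i j / w i j\<close> over it.
    \<open>W j\<close> multiplies only equations, so its sign is irrelevant and being nonzero
    suffices.\<close>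
  define W where "W j = (\<Prod>i\<le>s. w i j)" for j
  define u where "u i j = v i j * (\<Prod>i'\<in>{..s} - {i}. w i' j)" for i j
  define unit :: "'d option \<Rightarrow> 'd option \<Rightarrow> int poly" where "unit j = (\<lambda>j'. of_bool (j = j'))" for j
  \<comment> \<open>The coordinate \<open>None\<close> of the point homogenises the constraints.\<close>
  define bary where "bary = (\<lambda>j. (\<lambda>j'. - W j * unit (Some j) j', \<lambda>i. u i j)) ` UNIV \<union>
    {(\<lambda>j'. - unit None j', \<lambda>i :: nat. 1)}"
  \<comment> \<open>Each equation in \<open>bary\<close> becomes two opposite inequalities; the last
    family says that every weight \<open>y k\<close> is nonnegative.\<close>
  define C where "C = bary \<union> (\<lambda>(a, c). (\<lambda>j. - a j, \<lambda>i. - c i)) ` bary \<union>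
    (\<lambda>k. (\<lambda>j. 0, \<lambda>i. - of_bool (i = k))) ` {..s}"
  have finC: "finite C"
    by (simp add: C_def bary_def)
  have lin_unit: "lin UNIV (\<lambda>j'. p * unit j j') n x = of_int (poly p n) * x j" for p j n x
  proof -
    have "lin UNIV (\<lambda>j'. p * unit j j') n x = (\<Sum>j'\<in>UNIV. if j = j' then of_int (poly p n) * x j' else 0)"
      unfolding lin_def unit_def by (intro sum.cong) auto
    then show ?thesis by simp
  qed
  have lin_minus: "lin V (\<lambda>j. - a j) n x = - lin V a n x" for V and a :: "'v \<Rightarrow> int poly" and n x
    by (simp add: lin_def sum_negf)
  have lin_delta: "lin {..s} (\<lambda>i. - of_bool (i = k)) n y = - y k" if "k \<le> s" for k n y
  proof -
    have "lin {..s} (\<lambda>i. - of_bool (i = k)) n y = (\<Sum>i\<le>s. if k = i then - y i else 0)"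
      unfolding lin_def by (intro sum.cong) auto
    then show ?thesis using that by simp
  qed
  obtain C' where C': "finite C'" and ev: "eventually (\<lambda>n. \<forall>x.
    (\<exists>y. \<forall>(a, c)\<in>C. lin UNIV a n x + lin {..s} c n y \<le> 0) \<longleftrightarrow> (\<forall>a\<in>C'. lin UNIV a n x \<le> 0)) at_top"
    using fourier_motzkin[OF _ finC, of "{..s}" UNIV] by auto
  have "eventually (\<lambda>n. \<forall>i\<in>{..s}. \<forall>j\<in>UNIV. poly (w i j) n \<noteq> 0) at_top"
    using w_nonzero by (intro eventually_ball_finite ballI eventually_poly_nonzero) auto
  with ev have "eventually (\<lambda>n. \<forall>x. x \<in> ratio_polytope s v w n \<longleftrightarrow>
    (\<forall>a\<in>C'. lin UNIV a n (\<lambda>j. case j of None \<Rightarrow> 1 | Some j \<Rightarrow> x $ j) \<le> 0)) at_top"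
  proof eventually_elim
    case (elim n)
    show ?case
    proof
      fix x :: "real ^ 'd"
      define x' where "x' = (\<lambda>j. case j of None \<Rightarrow> 1 | Some j \<Rightarrow> x $ j)"
      have wn: "poly (w i j) n \<noteq> 0" if "i \<le> s" for i j
        using elim(2) that by simp
      have Wn: "poly (W j) n \<noteq> 0" for j
        using wn by (simp add: W_def poly_prod)
      have un: "of_int (poly (u i j) n) = of_int (poly (W j) n) * (ratio_point (v i) (w i) n $ j)"
        if "i \<le> s" for i j
      proof -
        have "W j = w i j * (\<Prod>i'\<in>{..s} - {i}. w i' j)"
          unfolding W_def using that by (subst prod.remove[of _ i]) auto
        then show ?thesis
          using wn[OF that, of j] by (simp add: u_def ratio_point_def)
      qed
      have bary_iff: "(\<forall>(a, c)\<in>bary. lin UNIV a n x' + lin {..s} c n y = 0) \<longleftrightarrow>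
          sum y {..s} = 1 \<and> (\<Sum>i\<le>s. y i *\<^sub>R ratio_point (v i) (w i) n) = x" for y
      proof -
        have "lin {..s} (\<lambda>i. u i j) n y =
            of_int (poly (W j) n) * ((\<Sum>i\<le>s. y i *\<^sub>R ratio_point (v i) (w i) n) $ j)" for j
          unfolding lin_def sum_component sum_distrib_left using un by (intro sum.cong) auto
        then have "lin UNIV (\<lambda>j'. - W j * unit (Some j) j') n x' + lin {..s} (\<lambda>i. u i j) n y =
            of_int (poly (W j) n) * ((\<Sum>i\<le>s. y i *\<^sub>R ratio_point (v i) (w i) n) $ j - x $ j)" for j
          unfolding lin_unit by (simp add: x'_def right_diff_distrib del: mult_minus_left sum_component)
        then have "lin UNIV (\<lambda>j'. - W j * unit (Some j) j') n x' + lin {..s} (\<lambda>i. u i j) n y = 0 \<longleftrightarrow>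
            (\<Sum>i\<le>s. y i *\<^sub>R ratio_point (v i) (w i) n) $ j = x $ j" for j
          using Wn[of j] by (simp del: sum_component)
        moreover have "lin UNIV (\<lambda>j'. - unit None j') n x' + lin {..s} (\<lambda>i. 1) n y = 0 \<longleftrightarrow> sum y {..s} = 1"
          using lin_unit[of "- 1" None n x'] by (simp add: lin_def[of "{..s}"] x'_def)
        ultimately show ?thesis
          unfolding bary_def vec_eq_iff by (auto simp del: sum_component)
      qed
      have "(\<forall>(a, c)\<in>C. lin UNIV a n x' + lin {..s} c n y \<le> 0) \<longleftrightarrow>
          (\<forall>i\<in>{..s}. 0 \<le> y i) \<and> sum y {..s} = 1 \<and> (\<Sum>i\<le>s. y i *\<^sub>R ratio_point (v i) (w i) n) = x" for y
      proof -
        have "(\<forall>(a, c)\<in>C. lin UNIV a n x' + lin {..s} c n y \<le> 0) \<longleftrightarrow>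
          (\<forall>(a, c)\<in>bary. lin UNIV a n x' + lin {..s} c n y \<le> 0 \<and> - lin UNIV a n x' - lin {..s} c n y \<le> 0) \<and>
          (\<forall>k\<in>{..s}. lin UNIV (\<lambda>j :: 'd option. 0) n x' + lin {..s} (\<lambda>i. - of_bool (i = k)) n y \<le> 0)"
          unfolding C_def by (auto simp: ball_Un lin_minus)
        also have "(\<forall>k\<in>{..s}. lin UNIV (\<lambda>j :: 'd option. 0) n x' + lin {..s} (\<lambda>i. - of_bool (i = k)) n y \<le> 0) \<longleftrightarrow>
            (\<forall>i\<in>{..s}. 0 \<le> y i)"
          by (simp add: lin_delta lin_def[of UNIV])
        also have "(\<forall>(a, c)\<in>bary. lin UNIV a n x' + lin {..s} c n y \<le> 0 \<and> - lin UNIV a n x' - lin {..s} c n y \<le> 0) \<longleftrightarrow>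
            (\<forall>(a, c)\<in>bary. lin UNIV a n x' + lin {..s} c n y = 0)"
          by (intro ball_cong) auto
        finally show ?thesis
          unfolding bary_iff by blast
      qed
      then have "x \<in> ratio_polytope s v w n \<longleftrightarrow> (\<exists>y. \<forall>(a, c)\<in>C. lin UNIV a n x' + lin {..s} c n y \<le> 0)"
        unfolding ratio_polytope_def atLeast0AtMost by (simp add: convex_hull_image_finite)
      then show "x \<in> ratio_polytope s v w n \<longleftrightarrow>
          (\<forall>a\<in>C'. lin UNIV a n (\<lambda>j. case j of None \<Rightarrow> 1 | Some j \<Rightarrow> x $ j) \<le> 0)"
        using elim(1) unfolding x'_def by blast
    qed
  qed
  with C' show ?thesis by blast
qed

text \<open>A nonzero integer denominator has absolute value at least 1, and a quotient by 0 is 0,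
  so the numerators alone bound the vertices. A box around them is convex and hence contains the
  hull.\<close>

lemma ratio_polytope_eventually_bounded:
  fixes v w :: "nat \<Rightarrow> 'd::finite \<Rightarrow> int poly"
  shows "\<exists>m. eventually (\<lambda>n. \<forall>x\<in>ratio_polytope s v w n. \<forall>j. \<bar>x $ j\<bar> \<le> of_int (n ^ m)) at_top"
proof -
  define H where "H n = (\<Sum>i\<le>s. \<Sum>j\<in>UNIV. \<bar>poly (v i j) n\<bar>)" for n
  have "poly_bounded H"
    unfolding H_def by (intro poly_bounded_sum poly_bounded_abs poly_bounded_poly)
  then obtain m where "eventually (\<lambda>n. \<bar>H n\<bar> \<le> n ^ m) at_top"
    unfolding poly_bounded_def by blast
  then have "eventually (\<lambda>n. \<forall>x\<in>ratio_polytope s v w n. \<forall>j. \<bar>x $ j\<bar> \<le> of_int (n ^ m)) at_top"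
  proof eventually_elim
    case (elim n)
    define B where "B = {x :: real ^ 'd. \<forall>j. x $ j \<in> {- of_int (n ^ m)..of_int (n ^ m)}}"
    have "convex B"
      unfolding B_def by (rule convex_box_cart) (simp only: Collect_mem_eq convex_real_interval)
    moreover have "ratio_point (v i) (w i) n \<in> B" if "i \<le> s" for i
    proof -
      have "\<bar>real_of_int (poly (v i j) n) / real_of_int (poly (w i j) n)\<bar> \<le> of_int (n ^ m)" for j
      proof -
        have "\<bar>poly (v i j) n\<bar> \<le> (\<Sum>j\<in>UNIV. \<bar>poly (v i j) n\<bar>)"
          by (rule member_le_sum) auto
        also have "\<dots> \<le> H n"
          unfolding H_def using that
          by (intro member_le_sum[where f = "\<lambda>i. \<Sum>j\<in>UNIV. \<bar>poly (v i j) n\<bar>"]) (auto intro: sum_nonneg)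
        finally have le: "\<bar>poly (v i j) n\<bar> \<le> n ^ m" using elim by linarith
        have "\<bar>real_of_int (poly (v i j) n) / real_of_int (poly (w i j) n)\<bar> \<le> \<bar>real_of_int (poly (v i j) n)\<bar>"
        proof (cases "poly (w i j) n = 0")
          case False
          then have "1 \<le> \<bar>real_of_int (poly (w i j) n)\<bar>" by linarith
          then have "\<bar>real_of_int (poly (v i j) n)\<bar> * 1 \<le>
              \<bar>real_of_int (poly (v i j) n)\<bar> * \<bar>real_of_int (poly (w i j) n)\<bar>"
            by (intro mult_left_mono) auto
          then show ?thesis
            using False by (simp add: abs_divide divide_le_eq)
        qed simp
        also have "\<dots> \<le> of_int (n ^ m)"
          using le by (metis of_int_abs of_int_le_iff)
        finally show ?thesis .
      qed
      then have "ratio_point (v i) (w i) n $ j \<in> {- of_int (n ^ m)..of_int (n ^ m)}" for j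
        unfolding ratio_point_def vec_lambda_beta atLeastAtMost_iff abs_le_iff by (metis minus_le_iff)
      then show ?thesis
        unfolding B_def by blast
    qed
    ultimately have "ratio_polytope s v w n \<subseteq> B"
      unfolding ratio_polytope_def by (intro hull_minimal) auto
    then show ?case
      by (auto simp: B_def abs_le_iff minus_le_iff subset_iff)
  qed
  then show ?thesis by blast
qed

theorem theorem1p4:
  fixes s :: nat
    and v w :: "nat \<Rightarrow> 'd::finite \<Rightarrow> int poly"
    and f :: "int \<Rightarrow> int"
  assumes w_nonzero: "\<And>i j. i \<le> s \<Longrightarrow> w i j \<noteq> 0"
    and f_count: "\<And>n. n > 0 \<Longrightarrow> (\<forall>i\<le>s. \<forall>j. poly (w i j) n \<noteq> 0) \<Longrightarrow>
      f n = int (card (ratio_polytope s v w n \<inter> integer_lattice))"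
  shows "f \<in> QP_eventually"
proof -
  obtain C where C: "finite C" and lin: "eventually (\<lambda>n. \<forall>x. x \<in> ratio_polytope s v w n \<longleftrightarrow>
      (\<forall>a\<in>C. lin UNIV a n (\<lambda>j. case j of None \<Rightarrow> 1 | Some j \<Rightarrow> x $ j) \<le> 0)) at_top"
    using ratio_polytope_eventually_linear[of s w v] w_nonzero by auto
  obtain m where m: "eventually (\<lambda>n. \<forall>x\<in>ratio_polytope s v w n. \<forall>j. \<bar>x $ j\<bar> \<le> of_int (n ^ m)) at_top"
    using ratio_polytope_eventually_bounded by blast
  \<comment> \<open>The coefficient at \<open>None\<close> is the constant term of a constraint, so
    it appears negated on the right.\<close>
  define X where "X n = {x :: 'd \<Rightarrow> int. (\<forall>j. j \<notin> UNIV \<longrightarrow> x j = 0) \<and>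
    (\<forall>a\<in>C. (\<Sum>j\<in>UNIV. poly (a (Some j)) n * x j) \<le> poly (- a None) n)}" for n
  define vec where "vec x = (\<chi> j. real_of_int (x j))" for x :: "'d \<Rightarrow> int"
  have X: "eventually (\<lambda>n. \<forall>x. x \<in> X n \<longleftrightarrow> vec x \<in> ratio_polytope s v w n) at_top"
    using lin
  proof eventually_elim
    case (elim n)
    have "lin UNIV a n (\<lambda>j. case j of None \<Rightarrow> 1 | Some j \<Rightarrow> vec x $ j) =
        of_int ((\<Sum>j\<in>UNIV. poly (a (Some j)) n * x j) - poly (- a None) n)" for a and x :: "'d \<Rightarrow> int"
      by (simp add: lin_def UNIV_option_conv sum.reindex vec_def)
    then have "lin UNIV a n (\<lambda>j. case j of None \<Rightarrow> 1 | Some j \<Rightarrow> vec x $ j) \<le> 0 \<longleftrightarrow>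
        (\<Sum>j\<in>UNIV. poly (a (Some j)) n * x j) \<le> poly (- a None) n" for a and x :: "'d \<Rightarrow> int"
      by (simp only: of_int_le_0_iff diff_le_0_iff_le)
    then show ?case
      using elim unfolding X_def by simp
  qed
  have "eventually (\<lambda>n. \<forall>x\<in>X n. \<forall>j\<in>UNIV. \<bar>x j\<bar> \<le> n ^ m) at_top"
    using X m
  proof eventually_elim
    case (elim n)
    have "\<bar>x j\<bar> \<le> n ^ m" if "x \<in> X n" for x j
    proof -
      have "\<bar>vec x $ j\<bar> \<le> of_int (n ^ m)" using elim that by blast
      then show ?thesis
        unfolding vec_def vec_lambda_beta by (metis of_int_abs of_int_le_iff)
    qed
    then show ?case by blast
  qed
  then have "(\<lambda>n. int (card (X n))) \<in> QP_eventually"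
    unfolding X_def
    by (intro QP_eventually_card_ineq_sols[where a = "\<lambda>a j. a (Some j)" and b = "\<lambda>a. - a None" and m = m] C) auto
  moreover have "eventually (\<lambda>n. \<forall>i\<in>{..s}. \<forall>j\<in>UNIV. poly (w i j) n \<noteq> 0) at_top"
    using w_nonzero by (intro eventually_ball_finite ballI eventually_poly_nonzero) auto
  \<comment> \<open>\<open>f\<close> is known only where n is positive and no denominator vanishes;
    both hold for all large n.\<close>
  then have "eventually (\<lambda>n. int (card (X n)) = f n) at_top"
    using X eventually_gt_at_top[of 0]
  proof eventually_elim
    case (elim n)
    have "inj_on vec (X n)"
      by (auto simp: inj_on_def vec_def vec_eq_iff fun_eq_iff)
    moreover have "vec ` X n = ratio_polytope s v w n \<inter> integer_lattice"
    proof (intro equalityI subsetI)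
      fix y assume y: "y \<in> ratio_polytope s v w n \<inter> integer_lattice"
      then have "\<forall>j. \<exists>k. y $ j = of_int k"
        by (auto simp: integer_lattice_def elim: Ints_cases)
      then obtain x where "\<And>j. y $ j = of_int (x j)" by metis
      then have "y = vec x" by (simp add: vec_def vec_eq_iff)
      then show "y \<in> vec ` X n" using y elim by blast
    qed (use elim in \<open>auto simp: integer_lattice_def vec_def\<close>)
    ultimately have "card (X n) = card (ratio_polytope s v w n \<inter> integer_lattice)"
      using card_image by metis
    then show ?case using f_count[of n] elim by simp
  qed
  ultimately show ?thesis by (rule QP_eventually_cong)
qed

end
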